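(* Let $k$ be a subfield of a field $f$ and let $G$ be a subgroup of $f^*$ such that: $k^*\le G$; $G/k^*$ is torsion; if $G/k^*$ has an element of order $4$, then $k$ contains a primitive $4$-th root of $1$; for every prime $p\in \pi(t(G))\cap\pi(G/k^* )$ the field $k$ contains a primitive $p$-th root of $1$; and $\operatorname{char}k\notin\pi(G/k^* )$. Then $k(G)=k\otimes_{kk^*}kG=\bigoplus_{t\in T}kt$, where $T$ is a transversal to $k^*$ in $G$; that is, the elements of $T$ are linearly independent over $k$ and span $k(G)$ as a $k$-vector space.
   Context: $f^*$ is the multiplicative group of $f$; $t(A)$ is the torsion subgroup of an abelian group $A$; $\pi(X)$ is the set of primes dividing orders of elements of a torsion group $X$; $k(S)$ is the subfield generated by $k$ and $S$. $kG$ denotes the group algebra; $k(G)$ is regarded as a $kG$-module and $k$ as a $kk^*$-module via multiplication. *)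

theory Defs
  imports "HOL-Computational_Algebra.Primes"
begin

(* All structures live inside an ambient field of type 'a::field (the field f). *)

definition is_subfield :: "'a::field set \<Rightarrow> bool" where
  "is_subfield S \<longleftrightarrow> 0 \<in> S \<and> 1 \<in> S \<and>
     (\<forall>x\<in>S. \<forall>y\<in>S. x + y \<in> S \<and> x * y \<in> S) \<and>
     (\<forall>x\<in>S. - x \<in> S \<and> inverse x \<in> S)"

definition is_mult_subgroup :: "'a::field set \<Rightarrow> bool" where
  "is_mult_subgroup G \<longleftrightarrow> G \<subseteq> - {0} \<and> 1 \<in> G \<and>
     (\<forall>x\<in>G. \<forall>y\<in>G. x * y \<in> G) \<and> (\<forall>x\<in>G. inverse x \<in> G)"

definition gen_field :: "'a::field set \<Rightarrow> 'a set \<Rightarrow> 'a set" where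
  "gen_field K S = \<Inter> {F. is_subfield F \<and> K \<union> S \<subseteq> F}"

definition elem_order :: "'a::field \<Rightarrow> nat" where
  "elem_order g = (if \<exists>n>0. g ^ n = 1 then (LEAST n. n > 0 \<and> g ^ n = 1) else 0)"

definition coset_order :: "'a::field set \<Rightarrow> 'a \<Rightarrow> nat" where
  "coset_order K g = (if \<exists>n>0. g ^ n \<in> K then (LEAST n. n > 0 \<and> g ^ n \<in> K) else 0)"

definition pi_torsion :: "'a::field set \<Rightarrow> nat set" where
  "pi_torsion G = {p. prime p \<and> (\<exists>g\<in>G. elem_order g > 0 \<and> p dvd elem_order g)}"

definition pi_quot :: "'a::field set \<Rightarrow> 'a set \<Rightarrow> nat set" where
  "pi_quot G K = {p. prime p \<and> (\<exists>g\<in>G. coset_order K g > 0 \<and> p dvd coset_order K g)}"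

definition primitive_root_of_unity :: "'a::field \<Rightarrow> nat \<Rightarrow> bool" where
  "primitive_root_of_unity z n \<longleftrightarrow> n > 0 \<and> z ^ n = 1 \<and> (\<forall>m. 0 < m \<and> m < n \<longrightarrow> z ^ m \<noteq> 1)"

definition is_transversal :: "'a::field set \<Rightarrow> 'a set \<Rightarrow> 'a set \<Rightarrow> bool" where
  "is_transversal K G T \<longleftrightarrow> T \<subseteq> G \<and>
     (\<forall>g\<in>G. \<exists>!t. t \<in> T \<and> g * inverse t \<in> K - {0})"

definition lin_indep_over :: "'a::field set \<Rightarrow> 'a set \<Rightarrow> bool" where
  "lin_indep_over K T \<longleftrightarrow> (\<forall>S c. finite S \<and> S \<subseteq> T \<and> (\<forall>t\<in>S. c t \<in> K) \<and>
      (\<Sum>t\<in>S. c t * t) = 0 \<longrightarrow> (\<forall>t\<in>S. c t = 0))"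

definition span_over :: "'a::field set \<Rightarrow> 'a set \<Rightarrow> 'a set" where
  "span_over K T = {x. \<exists>S c. finite S \<and> S \<subseteq> T \<and> (\<forall>t\<in>S. c t \<in> K) \<and> x = (\<Sum>t\<in>S. c t * t)}"

end

theory Submission
  imports Defs "HOL-Algebra.Algebraic_Closure_Type" "Jordan_Normal_Form.Determinant"
begin

text \<open>Independence is proved by induction on an exponent \<open>n\<close> with \<open>g ^ n \<in> K\<close> for all members of
  a finite pairwise inequivalent family, inside an algebraic closure. Let \<open>p\<close> be the largest prime
  factor of \<open>n\<close> and split each member into a \<open>p\<close>-part and a prime-to-\<open>p\<close> part. The latter and a
  \<open>p\<close>-th root of unity lie in a field \<open>F\<close> whose degree over \<open>K\<close> is a product of numbers smaller
  than \<open>p\<close>; taking norms from \<open>F\<close> shows that \<open>p\<close>-parts inequivalent modulo \<open>K\<close> stay inequivalent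
  modulo \<open>F\<close>. Over \<open>F\<close>, which contains the \<open>p\<close>-th roots of unity, Kummer theory makes
  inequivalent \<open>p\<close>-parts independent: if \<open>a ^ p \<in> F\<close>, \<open>a \<notin> F\<close>, the automorphism
  \<open>a \<mapsto> \<zeta> a\<close> of \<open>F(a)\<close> shows that the only \<open>p\<close>-power radicals in \<open>F(a)\<close> are \<open>c * a ^ e\<close> with
  \<open>c \<in> F\<close>; for \<open>p = 2\<close> this is where elements of order 4 matter, as the excluded case is a
  conjugate quotient of order 4 outside \<open>F\<close>. Comparing coefficients of the \<open>p\<close>-parts leaves relations between prime-to-\<open>p\<close> parts.
  For the span, adjoining finitely many elements of \<open>G\<close> to \<open>K\<close> as a ring already gives a field.\<close>

hide_const (open) Divisibility.prime Polynomials.degree up_ring.coeff up_ring.monom module.smult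

section \<open>Simple algebraic extensions of subfields\<close>

context
  fixes K :: "'a::field set"
  assumes K: "is_subfield K"
begin

lemma subfield_0: "0 \<in> K" and subfield_1: "1 \<in> K"
  and subfield_add: "x \<in> K \<Longrightarrow> y \<in> K \<Longrightarrow> x + y \<in> K"
  and subfield_mult: "x \<in> K \<Longrightarrow> y \<in> K \<Longrightarrow> x * y \<in> K"
  and subfield_uminus: "x \<in> K \<Longrightarrow> - x \<in> K"
  and subfield_inverse: "x \<in> K \<Longrightarrow> inverse x \<in> K"
  using K unfolding is_subfield_def by auto

lemma subfield_diff: "x \<in> K \<Longrightarrow> y \<in> K \<Longrightarrow> x - y \<in> K"
  using subfield_add[of x "- y"] subfield_uminus[of y] by simp

lemma subfield_divide: "x \<in> K \<Longrightarrow> y \<in> K \<Longrightarrow> x / y \<in> K"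
  using subfield_mult[of x "inverse y"] subfield_inverse[of y] by (simp add: divide_inverse)

lemma subfield_power: "x \<in> K \<Longrightarrow> x ^ n \<in> K"
  by (induction n) (auto simp: subfield_1 subfield_mult)

lemma subfield_sum: "(\<And>i. i \<in> I \<Longrightarrow> f i \<in> K) \<Longrightarrow> sum f I \<in> K"
  by (induction I rule: infinite_finite_induct) (auto simp: subfield_0 subfield_add)

lemma subfield_prod: "(\<And>i. i \<in> I \<Longrightarrow> f i \<in> K) \<Longrightarrow> prod f I \<in> K"
  by (induction I rule: infinite_finite_induct) (auto simp: subfield_1 subfield_mult)

lemmas subfield_closed = subfield_0 subfield_1 subfield_add subfield_mult subfield_uminus
  subfield_inverse subfield_diff subfield_divide subfield_power subfield_sum subfield_prod

end

lemma degree_monom_diff_const: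
  fixes c :: "'a::field"
  assumes "n > 0"
  shows "degree (monom 1 n - [:c:]) = n" "monom 1 n - [:c:] \<noteq> 0"
proof -
  show deg: "degree (monom 1 n - [:c:]) = n" using assms
    by (subst diff_conv_add_uminus, subst degree_add_eq_left) (auto simp: degree_monom_eq)
  thus "monom 1 n - [:c:] \<noteq> 0" using assms by auto
qed

section \<open>Polynomials with coefficients in a subfield, and adjunction of one element\<close>

definition poly_over :: "'a::field set \<Rightarrow> 'a poly \<Rightarrow> bool" where
  "poly_over K q \<longleftrightarrow> (\<forall>i. coeff q i \<in> K)"

text \<open>This is the ring \<open>K[y]\<close>; it is a field once \<open>y\<close> is algebraic
  over \<open>K\<close>. Describing it by values of polynomials makes division with remainder
  available.\<close>

definition adjoin :: "'a::field set \<Rightarrow> 'a \<Rightarrow> 'a set" where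
  "adjoin K y = {poly q y | q. poly_over K q}"

lemma adjoinI: "poly_over K q \<Longrightarrow> poly q y \<in> adjoin K y"
  unfolding adjoin_def by auto

context
  fixes K :: "'a::field set"
  assumes K: "is_subfield K"
begin

lemma poly_over_0: "poly_over K 0"
  and poly_over_add: "poly_over K p \<Longrightarrow> poly_over K q \<Longrightarrow> poly_over K (p + q)"
  and poly_over_diff: "poly_over K p \<Longrightarrow> poly_over K q \<Longrightarrow> poly_over K (p - q)"
  and poly_over_uminus: "poly_over K p \<Longrightarrow> poly_over K (- p)"
  and poly_over_smult: "c \<in> K \<Longrightarrow> poly_over K p \<Longrightarrow> poly_over K (smult c p)"
  and poly_over_monom: "c \<in> K \<Longrightarrow> poly_over K (monom c n)"
  and poly_over_mult: "poly_over K p \<Longrightarrow> poly_over K q \<Longrightarrow> poly_over K (p * q)"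
  unfolding poly_over_def
  by (auto simp: coeff_mult subfield_closed[OF K] intro!: subfield_sum[OF K])

lemma poly_over_pCons [simp]: "poly_over K (pCons a p) \<longleftrightarrow> a \<in> K \<and> poly_over K p"
  unfolding poly_over_def by (auto simp: coeff_pCons split: nat.splits)

text \<open>Division takes place among polynomials over the whole type. Long division by
  \<open>f\<close>, one coefficient at a time, divides only by the leading coefficient of
  \<open>f\<close> and so never leaves \<open>K\<close>.\<close>

lemma poly_over_mod: "poly_over K p \<Longrightarrow> poly_over K f \<Longrightarrow> poly_over K (p mod f)"
proof (cases "f = 0")
  case False
  assume p: "poly_over K p" and f: "poly_over K f"
  show ?thesis using p
  proof (induction p)
    case (pCons a p)
    let ?r = "pCons a (p mod f)"
    have "poly_over K ?r" using pCons by simp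
    moreover from this have "coeff ?r (degree f) / coeff f (degree f) \<in> K"
      using f unfolding poly_over_def by (intro subfield_divide[OF K]) auto
    ultimately show ?case using f False
      by (subst mod_pCons) (auto simp: Let_def intro!: poly_over_diff poly_over_smult)
  qed (simp add: poly_over_0)
qed simp

lemma poly_over_div: "poly_over K p \<Longrightarrow> poly_over K f \<Longrightarrow> poly_over K (p div f)"
proof (cases "f = 0")
  case False
  assume p: "poly_over K p" and f: "poly_over K f"
  show ?thesis using p
  proof (induction p)
    case (pCons a p)
    let ?r = "pCons a (p mod f)"
    have "poly_over K ?r" using pCons poly_over_mod f by simp
    from this have "coeff ?r (degree f) / coeff f (degree f) \<in> K"
      using f unfolding poly_over_def by (intro subfield_divide[OF K]) auto
    thus ?case using f False pCons
      by (subst div_pCons_eq) (auto simp: Let_def)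
  qed (simp add: poly_over_0)
qed (simp add: poly_over_0)

lemma poly_over_scale: "poly_over K p \<Longrightarrow> z \<in> K \<Longrightarrow> poly_over K (p \<circ>\<^sub>p [:0, z:])"
  by (induction p)
    (auto simp: pcompose_pCons poly_over_0 subfield_closed[OF K] intro!: poly_over_add poly_over_smult)

lemma subset_adjoin: "K \<subseteq> adjoin K y"
  using adjoinI[of K "[:c:]" y for c] poly_over_0 by auto

lemma adjoin_contains: "y \<in> adjoin K y"
  using adjoinI[of K "[:0, 1:]" y] by (simp add: poly_over_0 subfield_closed[OF K])

text \<open>Minimality is stated as the absence of relations of smaller degree, the form in which it
  yields inverses and bases. The bound by \<open>degree f\<close> later forces degrees below a given
  prime.\<close>

lemma minimal_poly_exists:
  assumes "poly_over K f" "f \<noteq> 0" "poly f y = 0"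
  obtains m where "poly_over K m" "m \<noteq> 0" "poly m y = 0"
    "\<And>q. poly_over K q \<Longrightarrow> poly q y = 0 \<Longrightarrow> degree q < degree m \<Longrightarrow> q = 0"
    "degree m \<le> degree f" "degree m > 0"
proof -
  let ?P = "\<lambda>m. poly_over K m \<and> m \<noteq> 0 \<and> poly m y = 0"
  obtain m where m: "?P m" "\<And>q. ?P q \<Longrightarrow> degree m \<le> degree q"
    using ex_has_least_nat[of ?P f degree] assms by blast
  have "degree m > 0"
  proof (rule ccontr)
    assume "\<not> ?thesis"
    then obtain c where "m = [:c:]" using degree_eq_zeroE by blast
    with m show False by auto
  qed
  moreover have "q = 0" if "poly_over K q" "poly q y = 0" "degree q < degree m" for q
    using m(2)[of q] that by fastforce
  ultimately show ?thesis using that[of m] m assms by blast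
qed

lemma radical_poly:
  assumes "n > 0" "c \<in> K"
  shows "poly_over K (monom 1 n - [:c:])" "monom 1 n - [:c:] \<noteq> 0" "degree (monom 1 n - [:c:]) = n"
proof -
  show "poly_over K (monom 1 n - [:c:])"
    using assms(2) subfield_1[OF K] by (intro poly_over_diff poly_over_monom) (auto simp: poly_over_0)
qed (use degree_monom_diff_const[OF assms(1)] in auto)

text \<open>Inverses come from Euclid's algorithm against the minimal polynomial: dividing it by
  the given polynomial leaves a remainder of smaller degree with nonzero value.\<close>

lemma adjoin_inverse:
  assumes m: "poly_over K m" "poly m y = 0"
    "\<And>q. poly_over K q \<Longrightarrow> poly q y = 0 \<Longrightarrow> degree q < degree m \<Longrightarrow> q = 0"
    and q: "poly_over K q" "poly q y \<noteq> 0" "degree q < degree m"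
  shows "\<exists>u. poly_over K u \<and> poly u y * poly q y = 1"
  using q
proof (induction "degree q" arbitrary: q rule: less_induct)
  case less
  show ?case
  proof (cases "degree q = 0")
    case True
    then obtain c where c: "q = [:c:]" using degree_eq_zeroE by blast
    show ?thesis using less.prems c
      by (intro exI[of _ "[:inverse c:]"]) (auto simp: poly_over_0 subfield_closed[OF K])
  next
    case False
    define s r where "s = m div q" and "r = m mod q"
    have sr: "m = s * q + r" unfolding s_def r_def by simp
    have q0: "q \<noteq> 0" using False by auto
    have over: "poly_over K s" "poly_over K r"
      unfolding s_def r_def using poly_over_div poly_over_mod m less.prems by auto
    have eq: "poly r y = - (poly s y * poly q y)"
      using m(2) sr by (metis add.commute add_eq_0_iff poly_add poly_mult)
    have rq: "degree r < degree q"
      using degree_mod_less[of q m] q0 False unfolding r_def by auto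
    have "m \<noteq> 0" using less.prems by auto
    hence "s \<noteq> 0" using rq sr less.prems(3) by auto
    moreover have "degree s < degree m"
      using degree_div_less[of m q] less.prems(3) False unfolding s_def by auto
    ultimately have "poly s y \<noteq> 0" using m(3) over by blast
    hence "poly r y \<noteq> 0" using eq less.prems by simp
    then obtain u where u: "poly_over K u" "poly u y * poly r y = 1"
      using less.hyps[OF rq] over rq less.prems by fastforce
    have "poly (- (u * s)) y * poly q y = 1" using u eq by (simp add: algebra_simps)
    thus ?thesis using u over poly_over_mult poly_over_uminus by blast
  qed
qed

lemma is_subfield_adjoin:
  assumes "poly_over K f" "f \<noteq> 0" "poly f y = 0"
  shows "is_subfield (adjoin K y)"
proof -
  obtain m where m: "poly_over K m" "m \<noteq> 0" "poly m y = 0"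
    "\<And>q. poly_over K q \<Longrightarrow> poly q y = 0 \<Longrightarrow> degree q < degree m \<Longrightarrow> q = 0"
    "degree m > 0"
    using minimal_poly_exists[OF assms] by metis
  have inv: "inverse x \<in> adjoin K y" if x: "x \<in> adjoin K y" for x
  proof (cases "x = 0")
    case True thus ?thesis using x by simp
  next
    case False
    obtain q where q: "poly_over K q" "x = poly q y" using x unfolding adjoin_def by auto
    \<comment> \<open>The remainder modulo \<open>m\<close> has the same value at \<open>y\<close>
      and meets the degree bound of \<open>adjoin_inverse\<close>.\<close>
    have e: "x = poly (q mod m) y"
      using q m(3) by (metis poly_mod)
    have "degree (q mod m) < degree m"
      using degree_mod_less[of m q] m by auto
    moreover have "poly (q mod m) y \<noteq> 0" using e False by simp
    ultimately obtain u where u: "poly_over K u" "poly u y * poly (q mod m) y = 1"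
      using adjoin_inverse[OF m(1,3,4) poly_over_mod[OF q(1) m(1)]] by blast
    have "poly u y * x = 1" using u(2) e by simp
    hence "inverse x = poly u y" by (simp add: inverse_unique mult.commute)
    thus ?thesis using adjoinI[OF u(1)] by simp
  qed
  have ops: "x + z \<in> adjoin K y" "x * z \<in> adjoin K y" "- x \<in> adjoin K y"
    if "x \<in> adjoin K y" "z \<in> adjoin K y" for x z
  proof -
    obtain p q where pq: "poly_over K p" "x = poly p y" "poly_over K q" "z = poly q y"
      using \<open>x \<in> _\<close> \<open>z \<in> _\<close> unfolding adjoin_def by auto
    show "x + z \<in> adjoin K y" "x * z \<in> adjoin K y" "- x \<in> adjoin K y"
      using adjoinI[OF poly_over_add[OF pq(1,3)], of y] adjoinI[OF poly_over_mult[OF pq(1,3)], of y]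
        adjoinI[OF poly_over_uminus[OF pq(1)], of y] pq by auto
  qed
  have "0 \<in> adjoin K y" "1 \<in> adjoin K y"
    using subset_adjoin[of y] subfield_0[OF K] subfield_1[OF K] by auto
  thus ?thesis unfolding is_subfield_def using inv ops by (intro conjI ballI)
qed

end

section \<open>Norms\<close>

text \<open>Here \<open>n\<close> stands for the degree of \<open>F\<close> over \<open>K\<close>.
  Of the field norm only multiplicativity and the value on \<open>K\<close> are retained, so towers
  need only composition of maps.\<close>

definition has_norm :: "'a::field set \<Rightarrow> 'a set \<Rightarrow> nat \<Rightarrow> bool" where
  "has_norm K F n \<longleftrightarrow> (\<exists>N. (\<forall>x\<in>F. N x \<in> K) \<and> (\<forall>x\<in>F. \<forall>y\<in>F. N (x * y) = N x * N y) \<and>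
     (\<forall>x\<in>K. N x = x ^ n))"

lemma has_norm_trans:
  assumes K: "is_subfield K" and "has_norm K E m" "has_norm E F n" "K \<subseteq> E"
  shows "has_norm K F (m * n)"
proof -
  obtain N where N: "\<forall>x\<in>E. N x \<in> K" "\<forall>x\<in>E. \<forall>y\<in>E. N (x * y) = N x * N y" "\<forall>x\<in>K. N x = x ^ m"
    using assms(2) unfolding has_norm_def by blast
  obtain M where M: "\<forall>x\<in>F. M x \<in> E" "\<forall>x\<in>F. \<forall>y\<in>F. M (x * y) = M x * M y" "\<forall>x\<in>E. M x = x ^ n"
    using assms(3) unfolding has_norm_def by blast
  have "N (M x) = x ^ (m * n)" if "x \<in> K" for x
    using that M(3) N(3) assms(4) subfield_power[OF K that, of n]
    by (auto simp: power_mult[symmetric] mult.commute)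
  thus ?thesis unfolding has_norm_def using N M by (intro exI[of _ "\<lambda>x. N (M x)"]) auto
qed

text \<open>The witness is the norm of \<open>x\<close>: its \<open>q\<close>-th power is the norm
  of \<open>x ^ q\<close>, an element of \<open>K\<close>, on which the norm is the
  \<open>n\<close>-th power.\<close>

lemma has_norm_root:
  assumes K: "is_subfield K" and F: "is_subfield F" and "K \<subseteq> F" "has_norm K F n"
    and x: "x \<in> F" "x ^ q \<in> K"
  shows "\<exists>c\<in>K. c ^ q = (x ^ q) ^ n"
proof -
  obtain N where N: "\<forall>x\<in>F. N x \<in> K" "\<forall>x\<in>F. \<forall>y\<in>F. N (x * y) = N x * N y" "\<forall>x\<in>K. N x = x ^ n"
    using assms(4) unfolding has_norm_def by blast
  have "N (x ^ i) = N x ^ i" for i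
    using N x(1) subfield_1[OF K] subfield_power[OF F x(1)] by (induction i) auto
  hence "N x ^ q = (x ^ q) ^ n" using N(3) x(2) by metis
  thus ?thesis using N x by blast
qed

text \<open>The norm of \<open>x\<close> is the determinant of multiplication by \<open>x\<close>,
  written as a matrix in the basis \<open>b\<close>.\<close>

lemma has_norm_basis:
  fixes K F :: "'a::field set" and b :: "nat \<Rightarrow> 'a"
  assumes K: "is_subfield K" and F: "is_subfield F" and KF: "K \<subseteq> F"
    and b: "\<And>i. i < n \<Longrightarrow> b i \<in> F"
    and span: "\<And>x. x \<in> F \<Longrightarrow> \<exists>c. (\<forall>i<n. c i \<in> K) \<and> x = (\<Sum>i<n. c i * b i)"
    and indep: "\<And>c. \<forall>i<n. c i \<in> K \<Longrightarrow> (\<Sum>i<n. c i * b i) = 0 \<Longrightarrow> \<forall>i<n. c i = 0"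
  shows "has_norm K F n"
proof -
  obtain co where co: "\<And>x. x \<in> F \<Longrightarrow> (\<forall>i<n. co x i \<in> K) \<and> x = (\<Sum>i<n. co x i * b i)"
    using span by metis
  have uniq: "co x i = c i" if "x \<in> F" "\<forall>i<n. c i \<in> K" "x = (\<Sum>i<n. c i * b i)" "i < n" for x c i
  proof -
    have "(\<Sum>i<n. (co x i - c i) * b i) = 0"
      using co[OF that(1)] that(3) by (simp add: left_diff_distrib sum_subtractf)
    moreover have "\<forall>i<n. co x i - c i \<in> K" using co[OF that(1)] that(2) subfield_diff[OF K] by auto
    ultimately have "\<forall>i<n. co x i - c i = 0" by (rule indep[rotated])
    thus ?thesis using that(4) by auto
  qed
  define M where "M x = mat n n (\<lambda>(i, j). co (x * b i) j)" for x
  have M: "M x \<in> carrier_mat n n" for x unfolding M_def by auto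
  have xb: "x * b i \<in> F" if "x \<in> F" "i < n" for x i using that b subfield_mult[OF F] by auto
  \<comment> \<open>Row \<open>i\<close> of \<open>M x\<close> holds the coordinates of
    \<open>x * b i\<close>, so the factors come out in reverse order; the determinant does not
    notice.\<close>
  have mult: "M (x * y) = M y * M x" if xy: "x \<in> F" "y \<in> F" for x y
  proof (rule eq_matI)
    fix i j assume "i < dim_row (M y * M x)" "j < dim_col (M y * M x)"
    hence ij: "i < n" "j < n" unfolding M_def by auto
    have in_K: "co (z * b k) j \<in> K" if "z \<in> F" "k < n" "j < n" for z k j
      using co[OF xb[OF that(1,2)]] that(3) by blast
    have "x * y * b i = x * (y * b i)" by (simp add: mult_ac)
    also have "\<dots> = (\<Sum>k<n. co (y * b i) k * (x * b k))"
    proof -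
      have e: "y * b i = (\<Sum>k<n. co (y * b i) k * b k)" using co[OF xb[OF xy(2) ij(1)]] by blast
      show ?thesis by (subst e) (simp add: sum_distrib_left mult.left_commute)
    qed
    also have "\<dots> = (\<Sum>k<n. co (y * b i) k * (\<Sum>j<n. co (x * b k) j * b j))"
      using co[OF xb[OF xy(1)]] by (intro sum.cong) auto
    also have "\<dots> = (\<Sum>k<n. \<Sum>j<n. co (y * b i) k * co (x * b k) j * b j)"
      by (simp add: sum_distrib_left mult.assoc)
    also have "\<dots> = (\<Sum>j<n. (\<Sum>k<n. co (y * b i) k * co (x * b k) j) * b j)"
      by (subst sum.swap) (simp add: sum_distrib_right)
    finally have "co (x * y * b i) j = (\<Sum>k<n. co (y * b i) k * co (x * b k) j)"
      using xy ij in_K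
      by (intro uniq subfield_mult[OF F] b) (auto intro!: subfield_sum[OF K] subfield_mult[OF K])
    thus "M (x * y) $$ (i, j) = (M y * M x) $$ (i, j)"
      using ij unfolding M_def by (simp add: scalar_prod_def lessThan_atLeast0)
  qed (auto simp: M_def)
  have scalar: "M x = x \<cdot>\<^sub>m 1\<^sub>m n" if x: "x \<in> K" for x
  proof (rule eq_matI)
    fix i j assume "i < dim_row (x \<cdot>\<^sub>m 1\<^sub>m n)" "j < dim_col (x \<cdot>\<^sub>m 1\<^sub>m n)"
    hence ij: "i < n" "j < n" by auto
    have "co (x * b i) j = (if j = i then x else 0)"
      using x ij KF xb subfield_0[OF K]
      by (intro uniq) (auto simp: if_distrib[of "\<lambda>u. u * _"] sum.delta cong: if_cong)
    thus "M x $$ (i, j) = (x \<cdot>\<^sub>m 1\<^sub>m n) $$ (i, j)" using ij unfolding M_def by auto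
  qed (auto simp: M_def)
  \<comment> \<open>The Leibniz formula writes the determinant as a signed sum of products of
    entries, all of which are in \<open>K\<close>.\<close>
  have det_K: "det (M x) \<in> K" if x: "x \<in> F" for x
  proof -
    have "signof p * (\<Prod>i = 0..<n. M x $$ (i, p i)) \<in> K" if p: "p permutes {0..<n}" for p
    proof -
      have "M x $$ (i, p i) \<in> K" if "i \<in> {0..<n}" for i
      proof -
        have "p i < n" using permutes_in_image[OF p, of i] that by auto
        thus ?thesis using that co[OF xb[OF x, of i]] unfolding M_def by auto
      qed
      moreover have "(signof p :: 'a) \<in> K" using subfield_closed[OF K] unfolding sign_def by auto
      ultimately show ?thesis by (intro subfield_mult[OF K] subfield_prod[OF K]) auto
    qed
    thus ?thesis unfolding det_def'[OF M] by (intro subfield_sum[OF K]) auto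
  qed
  show ?thesis unfolding has_norm_def
  proof (intro exI[of _ "\<lambda>x. det (M x)"] conjI ballI)
    fix x y assume "x \<in> F" "y \<in> F"
    thus "det (M (x * y)) = det (M x) * det (M y)"
      by (simp add: mult det_mult[OF M M] mult.commute)
  qed (use det_K scalar in auto)
qed

text \<open>The powers of \<open>y\<close> below \<open>degree m\<close> form a basis: division by
  \<open>m\<close> shows that they span, minimality of \<open>m\<close> that they are
  independent.\<close>

lemma adjoin_has_norm:
  assumes K: "is_subfield K" and m: "poly_over K m" "m \<noteq> 0" "poly m y = 0"
    and min: "\<And>q. poly_over K q \<Longrightarrow> poly q y = 0 \<Longrightarrow> degree q < degree m \<Longrightarrow> q = 0"
    and d: "degree m > 0"
  shows "has_norm K (adjoin K y) (degree m)"
proof (rule has_norm_basis[where b = "\<lambda>i. y ^ i", OF K is_subfield_adjoin[OF K m] subset_adjoin[OF K]])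
  show "y ^ i \<in> adjoin K y" for i
    using subfield_power[OF is_subfield_adjoin[OF K m] adjoin_contains[OF K]] .
next
  fix x assume "x \<in> adjoin K y"
  then obtain q where q: "poly_over K q" "x = poly q y" unfolding adjoin_def by auto
  let ?r = "q mod m"
  have deg: "degree ?r < degree m" using degree_mod_less[of m q] m d by auto
  have co0: "coeff ?r i = 0" if "i \<notin> {..degree ?r}" for i
    using that by (intro coeff_eq_0) auto
  have "poly ?r y = (\<Sum>i<degree m. coeff ?r i * y ^ i)"
    unfolding poly_altdef using deg co0 by (intro sum.mono_neutral_left) auto
  hence "x = (\<Sum>i<degree m. coeff ?r i * y ^ i)" using q m by (metis poly_mod)
  moreover have "\<forall>i. coeff ?r i \<in> K"
    using poly_over_mod[OF K q(1) m(1)] unfolding poly_over_def .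
  ultimately show "\<exists>c. (\<forall>i<degree m. c i \<in> K) \<and> x = (\<Sum>i<degree m. c i * y ^ i)"
    by (intro exI[of _ "coeff ?r"]) blast
next
  fix c assume c: "\<forall>i<degree m. c i \<in> K" "(\<Sum>i<degree m. c i * y ^ i) = 0"
  define q where "q = (\<Sum>i<degree m. monom (c i) i)"
  have co: "coeff q i = (if i < degree m then c i else 0)" for i
    unfolding q_def by (auto simp: coeff_sum sum.delta)
  have "poly q y = 0" unfolding q_def using c(2) by (simp add: poly_sum poly_monom)
  moreover have "poly_over K q" unfolding poly_over_def co using c subfield_0[OF K] by auto
  moreover have "degree q < degree m"
    using co d by (intro degree_lessI) auto
  ultimately have "q = 0" using min by blast
  hence "c i = 0" if "i < degree m" for i using co[of i] that by simp
  thus "\<forall>i<degree m. c i = 0" by blast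
qed

section \<open>Kummer extensions of prime degree\<close>

lemma ex_step_to_True:
  fixes P :: "nat \<Rightarrow> bool"
  assumes "\<not> P 0" "P M"
  shows "\<exists>u<M. \<not> P u \<and> P (Suc u)"
  using assms by (induction M) (auto simp: less_Suc_eq)

lemma power_eq_1_coprime:
  fixes w :: "'a::field"
  assumes "w ^ p = 1" "w ^ k = 1" "coprime k p" "k \<noteq> 0"
  shows "w = 1"
proof -
  obtain x y where "k * x = p * y + 1" using bezout_nat[of k p] assms by auto
  hence "(w ^ k) ^ x = (w ^ p) ^ y * w" by (metis power_add power_mult power_one_right)
  thus ?thesis using assms by simp
qed

text \<open>By Bezout, \<open>w\<close> is a quotient of a power of \<open>w ^ k\<close> by a power
  of \<open>w ^ p\<close>.\<close>

lemma coprime_power_in_subfield: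
  assumes K: "is_subfield K" and "w ^ p \<in> K" "w ^ k \<in> K" "coprime k p" "k \<noteq> 0"
  shows "w \<in> K"
proof (cases "w = 0")
  case False
  obtain x y where "k * x = p * y + 1" using bezout_nat[of k p] assms by auto
  hence "(w ^ k) ^ x = (w ^ p) ^ y * w" by (metis power_add power_mult power_one_right)
  hence "w = (w ^ k) ^ x / (w ^ p) ^ y" using False by simp
  thus ?thesis using assms subfield_divide[OF K] subfield_power[OF K] by metis
qed (simp add: subfield_0[OF K])

text \<open>The \<open>p\<close> powers of \<open>z\<close> are distinct and already exhaust the
  roots of \<open>X^p - 1\<close>, of which there are at most \<open>p\<close>.\<close>

lemma prime_root_of_unity_power:
  fixes z w :: "'a::field"
  assumes p: "prime p" and z: "z ^ p = 1" "z \<noteq> 1" and w: "w ^ p = 1"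
  shows "\<exists>i<p. w = z ^ i"
proof -
  have z0: "z \<noteq> 0" using z prime_gt_0_nat[OF p] by (metis power_0_left less_irrefl zero_neq_one)
  have "inj_on (\<lambda>i. z ^ i) {..<p}"
  proof (rule linorder_inj_onI)
    fix i j assume ij: "i < j" "i \<in> {..<p}" "j \<in> {..<p}"
    show "z ^ i \<noteq> z ^ j"
    proof
      assume "z ^ i = z ^ j"
      hence "z ^ (j - i) = 1" using ij z0 by (simp add: power_diff)
      moreover have "coprime (j - i) p"
        using ij p by (metis coprime_commute diff_less_mono2 dvd_imp_le lessThan_iff less_imp_diff_less
            linorder_not_le prime_imp_coprime_nat zero_less_diff)
      ultimately show False using power_eq_1_coprime[OF z(1), of "j - i"] z(2) ij by simp
    qed
  qed auto
  hence card: "card ((\<lambda>i. z ^ i) ` {..<p}) = p" by (simp add: card_image)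
  define f where "f = monom (1::'a) p - 1"
  have f: "degree f = p" "f \<noteq> 0"
    using degree_monom_diff_const[OF prime_gt_0_nat[OF p], of "1::'a"] unfolding f_def by (auto simp: one_pCons)
  have pf: "poly f x = x ^ p - 1" for x unfolding f_def by (simp add: poly_monom)
  have "(\<lambda>i. z ^ i) ` {..<p} \<subseteq> {x. poly f x = 0}"
    using z by (auto simp: pf power_mult[symmetric] mult.commute) (metis power_mult power_one mult.commute)
  moreover have "finite {x. poly f x = 0}" "card {x. poly f x = 0} \<le> p"
    using poly_roots_finite[OF f(2)] card_poly_roots_bound[OF f(2)] f(1) by auto
  ultimately have "(\<lambda>i. z ^ i) ` {..<p} = {x. poly f x = 0}"
    using card by (intro card_seteq) auto
  moreover have "w \<in> {x. poly f x = 0}" using w pf by simp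
  ultimately show ?thesis by (metis (no_types, lifting) imageE lessThan_iff)
qed

text \<open>The setting of a cyclic extension \<open>K(a)\<close> of degree \<open>p\<close>. The
  nontrivial \<open>z\<close> puts all \<open>p\<close>-th roots of unity into \<open>K\<close> and
  excludes characteristic \<open>p\<close>.\<close>

locale kummer =
  fixes K :: "'a::field set" and p :: nat and z a :: 'a
  assumes K: "is_subfield K" and p: "prime p"
    and z: "z \<in> K" "z ^ p = 1" "z \<noteq> 1"
    and a: "a \<notin> K" "a ^ p \<in> K"
begin

lemma root_of_unity_in_K: "w ^ p = 1 \<Longrightarrow> w \<in> K"
  using prime_root_of_unity_power[OF p z(2,3)] subfield_power[OF K z(1)] by metis

definition f :: "'a poly" where "f = monom 1 p - [:a ^ p:]"

lemma f: "poly_over K f" "f \<noteq> 0" "degree f = p" "poly f x = x ^ p - a ^ p"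
  unfolding f_def using radical_poly[OF K prime_gt_0_nat[OF p] a(2)] by (simp_all add: poly_monom)

lemma z0: "z \<noteq> 0" and a0: "a \<noteq> 0"
  using z a subfield_0[OF K] prime_gt_0_nat[OF p] by (auto simp: power_0_left)

lemma z_power_neq_1: "0 < i \<Longrightarrow> i < p \<Longrightarrow> z ^ i \<noteq> 1"
  using power_eq_1_coprime[OF z(2), of i] z(3) p
  by (metis coprime_commute dvd_imp_le leD less_not_refl prime_imp_coprime_nat)

text \<open>If the minimal polynomial of \<open>a\<close> had degree \<open>d < p\<close>, taking norms of \<open>a\<close> would make
  \<open>a ^ d\<close> an element of \<open>K\<close> up to a \<open>p\<close>-th root of unity.\<close>

lemma no_small_relation:
  assumes "poly_over K q" "poly q a = 0" "degree q < p"
  shows "q = 0"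
proof -
  obtain m where m: "poly_over K m" "m \<noteq> 0" "poly m a = 0"
    "\<And>q. poly_over K q \<Longrightarrow> poly q a = 0 \<Longrightarrow> degree q < degree m \<Longrightarrow> q = 0"
    "degree m \<le> degree f" "degree m > 0"
    using minimal_poly_exists[OF K f(1,2), of a] f(4) by auto
  have "\<not> degree m < p"
  proof
    let ?d = "degree m"
    assume d: "?d < p"
    obtain c where c: "c \<in> K" "c ^ p = (a ^ p) ^ ?d"
      using has_norm_root[OF K is_subfield_adjoin[OF K m(1-3)] subset_adjoin[OF K]
          adjoin_has_norm[OF K m(1-4,6)] adjoin_contains[OF K] a(2)] by blast
    have c0: "c \<noteq> 0" using c(2) a0 prime_gt_0_nat[OF p] by (auto simp: power_0_left)
    have "(a ^ ?d / c) ^ p = 1"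
      using c c0 a0 by (simp add: power_divide power_mult[symmetric] mult.commute)
    hence "a ^ ?d / c \<in> K" by (rule root_of_unity_in_K)
    hence "a ^ ?d / c * c \<in> K" using subfield_mult[OF K] c by blast
    hence "a ^ ?d \<in> K" using c0 by simp
    moreover have "coprime ?d p"
      using p d m(6) by (metis coprime_commute dvd_imp_le leD prime_imp_coprime_nat)
    ultimately have "a \<in> K" using coprime_power_in_subfield[OF K a(2)] m(6) by simp
    thus False using a by simp
  qed
  thus ?thesis using m(4) assms by fastforce
qed

text \<open>The exponents are given by an injective \<open>e\<close> because the relations to be
  treated run over an index set whose members are multiples of distinct powers of
  \<open>a\<close>.\<close>

lemma power_basis_independent:
  assumes "finite I" "\<And>i. i \<in> I \<Longrightarrow> c i \<in> K" "inj_on e I" "\<And>i. i \<in> I \<Longrightarrow> e i < p"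
    and "(\<Sum>i\<in>I. c i * a ^ e i) = 0" "i \<in> I"
  shows "c i = 0"
proof -
  define q where "q = (\<Sum>i\<in>I. monom (c i) (e i))"
  have co: "coeff q j = (\<Sum>i\<in>I. if e i = j then c i else 0)" for j
    unfolding q_def by (simp add: coeff_sum)
  have "poly_over K q" unfolding poly_over_def co
    using assms(2) subfield_0[OF K] by (auto intro!: subfield_sum[OF K])
  moreover have "poly q a = 0" unfolding q_def using assms(5) by (simp add: poly_sum poly_monom)
  moreover have "coeff q j = 0" if "j \<ge> p" for j
    unfolding co using assms(4) that by (intro sum.neutral) fastforce
  hence "degree q < p" using prime_gt_0_nat[OF p] by (intro degree_lessI) auto
  ultimately have "q = 0" using no_small_relation by blast
  hence "(\<Sum>k\<in>I. if e k = e i then c k else 0) = 0" using co[of "e i"] by simp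
  moreover have "(\<Sum>k\<in>I. if e k = e i then c k else 0) = (\<Sum>k\<in>I. if k = i then c k else 0)"
    using assms(3,6) by (intro sum.cong) (auto simp: inj_on_def)
  ultimately show ?thesis using assms(1,6) by simp
qed

section \<open>The field \<open>K(a)\<close> and its automorphism of order \<open>p\<close>\<close>

abbreviation "L \<equiv> adjoin K a"

lemma L: "is_subfield L"
  using is_subfield_adjoin[OF K f(1,2), of a] f(4) by simp

lemma L_repr:
  assumes "x \<in> L" obtains q where "poly_over K q" "x = poly q a" "degree q < p"
proof -
  obtain q where q: "poly_over K q" "x = poly q a" using assms unfolding adjoin_def by auto
  have "x = poly (q mod f) a" using q f(4)[of a] by (metis poly_mod diff_self)
  moreover have "degree (q mod f) < p"
    using degree_mod_less[of f q] f(2,3) prime_gt_0_nat[OF p] by auto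
  ultimately show ?thesis using that poly_over_mod[OF K q(1) f(1)] by blast
qed

text \<open>The automorphism over \<open>K\<close> that sends \<open>a\<close> to
  \<open>z * a\<close>. An arbitrary polynomial representing \<open>x\<close> is chosen;
  \<open>\<sigma>_poly\<close> shows that the choice does not matter.\<close>

definition \<sigma> :: "'a \<Rightarrow> 'a" where
  "\<sigma> x = poly (SOME q. poly_over K q \<and> poly q a = x) (z * a)"

text \<open>The difference of two polynomials with the same value at \<open>a\<close> is divisible
  by \<open>f\<close>, by \<open>no_small_relation\<close>, and \<open>f\<close> also vanishes at
  \<open>z * a\<close> since \<open>z ^ p = 1\<close>.\<close>

lemma \<sigma>_poly:
  assumes "poly_over K q"
  shows "\<sigma> (poly q a) = poly q (z * a)"
proof -
  define q' where "q' = (SOME r. poly_over K r \<and> poly r a = poly q a)"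
  have q': "poly_over K q'" "poly q' a = poly q a"
    using someI[of "\<lambda>r. poly_over K r \<and> poly r a = poly q a" q] assms unfolding q'_def by auto
  define r where "r = q' - q"
  have r: "poly_over K r" "poly r a = 0"
    unfolding r_def using q' assms poly_over_diff[OF K] by auto
  have "poly (r mod f) a = 0" using r f(4)[of a] by (metis poly_mod diff_self)
  moreover have "degree (r mod f) < p"
    using degree_mod_less[of f r] f(2,3) prime_gt_0_nat[OF p] by auto
  ultimately have "r mod f = 0" using no_small_relation poly_over_mod[OF K r(1) f(1)] by blast
  moreover have "poly f (z * a) = 0" using f(4) z by (simp add: power_mult_distrib)
  ultimately have "poly r (z * a) = 0" by (metis poly_mod poly_0)
  thus ?thesis unfolding r_def \<sigma>_def q'_def[symmetric] by simp
qed

lemma \<sigma>_const: "c \<in> K \<Longrightarrow> \<sigma> c = c"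
  using \<sigma>_poly[of "[:c:]"] by (simp add: K poly_over_0)

lemma \<sigma>_a: "\<sigma> a = z * a"
  using \<sigma>_poly[of "[:0, 1:]"] by (simp add: K poly_over_0 subfield_closed[OF K])

lemma \<sigma>_mult: "x \<in> L \<Longrightarrow> y \<in> L \<Longrightarrow> \<sigma> (x * y) = \<sigma> x * \<sigma> y"
  unfolding adjoin_def using \<sigma>_poly poly_over_mult[OF K] by (auto simp: poly_mult[symmetric] simp del: poly_mult)

lemma \<sigma>_in_L:
  assumes "x \<in> L" shows "\<sigma> x \<in> L"
proof -
  obtain q where q: "poly_over K q" "x = poly q a" using assms unfolding adjoin_def by auto
  have "\<sigma> x = poly (q \<circ>\<^sub>p [:0, z:]) a" using q \<sigma>_poly by (simp add: poly_pcompose mult.commute)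
  thus ?thesis using adjoinI poly_over_scale[OF K q(1) z(1)] by simp
qed

lemma \<sigma>_power: "x \<in> L \<Longrightarrow> \<sigma> (x ^ n) = \<sigma> x ^ n"
  by (induction n) (auto simp: \<sigma>_const subfield_1[OF K] \<sigma>_mult subfield_power[OF L])

lemma \<sigma>_quotient_power:
  assumes "x \<in> L" "x \<noteq> 0" "x ^ n \<in> K" shows "(\<sigma> x / x) ^ n = 1"
proof -
  have "\<sigma> x ^ n = x ^ n" using \<sigma>_power[OF assms(1), of n] \<sigma>_const[OF assms(3)] by simp
  thus ?thesis using assms(2) by (simp add: power_divide)
qed

text \<open>If \<open>q\<close> of degree below \<open>p\<close> represents \<open>x\<close>, then
  \<open>q(zX) - q(X)\<close> vanishes at \<open>a\<close> and hence is zero. Its coefficients are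
  \<open>(z ^ i - 1) * coeff q i\<close>, so \<open>q\<close> is constant.\<close>

lemma \<sigma>_fixed:
  assumes "x \<in> L" "\<sigma> x = x" shows "x \<in> K"
proof -
  obtain q where q: "poly_over K q" "x = poly q a" "degree q < p" using L_repr assms(1) .
  have co: "coeff (q' \<circ>\<^sub>p [:0, z:]) i = z ^ i * coeff q' i" for q' i
    by (induction q' arbitrary: i) (auto simp: pcompose_pCons coeff_pCons split: nat.splits)
  define r where "r = q \<circ>\<^sub>p [:0, z:] - q"
  have cr: "coeff r i = (z ^ i - 1) * coeff q i" for i
    unfolding r_def by (simp add: co algebra_simps)
  have "poly_over K r" unfolding r_def using poly_over_diff[OF K] poly_over_scale[OF K q(1) z(1)] q(1) by blast
  moreover have "poly r a = 0"
    unfolding r_def using assms(2) q(1,2) \<sigma>_poly by (simp add: poly_pcompose mult.commute)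
  moreover have "degree r < p"
    using prime_gt_0_nat[OF p] q(3) by (intro degree_lessI) (auto simp: cr coeff_eq_0)
  ultimately have r0: "r = 0" using no_small_relation by blast
  have "coeff q i = 0" if "i > 0" for i
  proof (cases "i < p")
    case True
    thus ?thesis using cr[of i] r0 z_power_neq_1 that by simp
  qed (use q(3) in \<open>auto simp: coeff_eq_0\<close>)
  hence "degree q = 0" by (metis degree_0 gr0I leading_coeff_0_iff)
  then obtain c where "q = [:c:]" using degree_eq_zeroE by blast
  thus ?thesis using q(1,2) by (simp add: K)
qed

lemma \<sigma>_funpow_in_L: "x \<in> L \<Longrightarrow> (\<sigma> ^^ j) x \<in> L"
  by (induction j) (auto simp: \<sigma>_in_L)

lemma \<sigma>_funpow_mult: "x \<in> L \<Longrightarrow> y \<in> L \<Longrightarrow> (\<sigma> ^^ j) (x * y) = (\<sigma> ^^ j) x * (\<sigma> ^^ j) y"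
  by (induction j) (auto simp: \<sigma>_mult \<sigma>_funpow_in_L)

lemma \<sigma>_funpow_power: "x \<in> L \<Longrightarrow> (\<sigma> ^^ j) (x ^ n) = ((\<sigma> ^^ j) x) ^ n"
  by (induction j) (auto simp: \<sigma>_power \<sigma>_funpow_in_L)

lemma \<sigma>_funpow_poly:
  assumes q: "poly_over K q" shows "(\<sigma> ^^ j) (poly q a) = poly q (z ^ j * a)"
proof (induction j)
  case (Suc j)
  have "(\<sigma> ^^ Suc j) (poly q a) = \<sigma> (poly (q \<circ>\<^sub>p [:0, z ^ j:]) a)"
    using Suc by (simp add: poly_pcompose mult.commute)
  also have "\<dots> = poly q (z ^ Suc j * a)"
    using \<sigma>_poly[OF poly_over_scale[OF K q subfield_power[OF K z(1)]]]
    by (simp add: poly_pcompose mult_ac)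
  finally show ?case .
qed simp

lemma \<sigma>_funpow_p: "x \<in> L \<Longrightarrow> (\<sigma> ^^ p) x = x"
  unfolding adjoin_def using \<sigma>_funpow_poly z by auto

text \<open>The easy half of Hilbert 90: the product telescopes, and the \<open>p\<close>-th iterate
  of \<open>\<sigma>\<close> is the identity.\<close>

lemma prod_conjugates_quotient:
  assumes x: "x \<in> L" "x \<noteq> 0"
  shows "(\<Prod>i<p. (\<sigma> ^^ i) (\<sigma> x / x)) = 1"
proof -
  let ?\<xi> = "\<sigma> x / x"
  have \<xi>: "?\<xi> \<in> L" using x \<sigma>_in_L subfield_divide[OF L] by blast
  have "(\<sigma> ^^ j) x = (\<Prod>i<j. (\<sigma> ^^ i) ?\<xi>) * x" for j
  proof (induction j)
    case (Suc j)
    have "(\<sigma> ^^ Suc j) x = (\<sigma> ^^ j) (?\<xi> * x)" using x by (simp add: funpow_swap1)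
    also have "\<dots> = (\<sigma> ^^ j) ?\<xi> * (\<sigma> ^^ j) x" using \<sigma>_funpow_mult \<xi> x by blast
    finally show ?case using Suc by (simp add: mult_ac)
  qed simp
  from this[of p] show ?thesis using \<sigma>_funpow_p x by simp
qed

text \<open>The quotient \<open>\<xi>\<close> of \<open>\<sigma> x\<close> by \<open>x\<close> is a
  root of unity of \<open>p\<close>-power order. Once it is known to lie in \<open>K\<close> it
  equals some \<open>z ^ e\<close>, and then \<open>x / a ^ e\<close> is fixed by
  \<open>\<sigma>\<close>. The hypothesis \<open>two\<close> excludes the one way in which
  \<open>\<xi>\<close> could fall outside \<open>K\<close>.\<close>

lemma radical_in_L:
  assumes x: "x \<in> L" "x \<noteq> 0" "x ^ (p ^ M) \<in> K"
    and two: "p = 2 \<Longrightarrow> (\<exists>i\<in>K. i ^ 2 = -1) \<or> x ^ 2 \<in> K"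
  shows "\<exists>c\<in>K. \<exists>e<p. x = c * a ^ e"
proof -
  define \<xi> where "\<xi> = \<sigma> x / x"
  have \<xi>L: "\<xi> \<in> L" unfolding \<xi>_def using x \<sigma>_in_L subfield_divide[OF L] by blast
  have \<xi>_pow: "\<xi> ^ n = 1" if "x ^ n \<in> K" for n
    unfolding \<xi>_def using \<sigma>_quotient_power[OF x(1,2) that] .
  have "\<xi> \<in> K"
  proof (rule ccontr)
    assume n: "\<xi> \<notin> K"
    define P where "P u \<longleftrightarrow> \<xi> ^ (p ^ u) \<in> K" for u
    have "P M" "\<not> P 0" unfolding P_def using n \<xi>_pow[OF x(3)] subfield_1[OF K] by auto
    then obtain u where u: "\<not> P u" "P (Suc u)" using ex_step_to_True by metis
    \<comment> \<open>The last \<open>p\<close>-power of \<open>\<xi>\<close> outside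
      \<open>K\<close>: its \<open>p\<close>-th power is in \<open>K\<close>, so its conjugates are
      its multiples by powers of \<open>z\<close>.\<close>
    define \<eta> where "\<eta> = \<xi> ^ (p ^ u)"
    have \<eta>: "\<eta> \<notin> K" "\<eta> ^ p \<in> K" "\<eta> \<in> L"
      using u \<xi>L subfield_power[OF L] unfolding \<eta>_def P_def by (auto simp: power_mult[symmetric] mult.commute)
    have \<eta>0: "\<eta> \<noteq> 0" using \<eta> subfield_0[OF K] by auto
    have "(\<sigma> \<eta> / \<eta>) ^ p = 1" using \<sigma>_quotient_power[OF \<eta>(3) \<eta>0 \<eta>(2)] .
    then obtain e where "\<sigma> \<eta> / \<eta> = z ^ e" using prime_root_of_unity_power[OF p z(2,3)] by blast
    hence e: "\<sigma> \<eta> = z ^ e * \<eta>" using \<eta>0 by (simp add: field_simps)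
    have zL: "z ^ k \<in> L" for k using subset_adjoin[OF K] subfield_power[OF K z(1)] by blast
    have conj: "(\<sigma> ^^ j) \<eta> = z ^ (e * j) * \<eta>" for j
    proof (induction j)
      case (Suc j)
      thus ?case using e \<sigma>_mult[OF zL \<eta>(3), of "e * j"] \<sigma>_const[OF subfield_power[OF K z(1), of "e * j"]]
        by (simp add: power_add mult_ac)
    qed simp
    have "(\<Prod>i<p. (\<sigma> ^^ i) \<eta>) = (\<Prod>i<p. (\<sigma> ^^ i) \<xi>) ^ (p ^ u)"
      unfolding \<eta>_def by (simp add: \<sigma>_funpow_power[OF \<xi>L] prod_power_distrib)
    also have "\<dots> = 1" using prod_conjugates_quotient[OF x(1,2)] unfolding \<xi>_def by simp
    finally have "(\<Prod>i<p. z ^ (e * i)) * \<eta> ^ p = 1" by (simp add: conj prod.distrib)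
    \<comment> \<open>Squaring disposes of the product of powers of \<open>z\<close>, which can be
      \<open>-1\<close> when \<open>p = 2\<close>.\<close>
    hence "(\<Prod>i<p. z ^ (e * i)) ^ 2 * (\<eta> ^ p) ^ 2 = 1" by (metis power_mult_distrib power_one)
    moreover have "(\<Prod>i<p. z ^ (e * i)) ^ 2 = 1"
    proof -
      have "2 * (\<Sum>i<p. i) = p * (p - 1)"
        using gauss_sum_nat[of "p - 1"] prime_gt_0_nat[OF p]
        by (simp add: lessThan_Suc_atMost[symmetric] atLeast0AtMost)
      moreover have "(\<Prod>i<p. z ^ (e * i)) ^ 2 = z ^ (e * (2 * (\<Sum>i<p. i)))"
        by (simp only: power_sum[symmetric] sum_distrib_left[symmetric] power_mult[symmetric])
          (simp add: mult_ac)
      ultimately have "(\<Prod>i<p. z ^ (e * i)) ^ 2 = z ^ (e * (p * (p - 1)))" by simp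
      also have "\<dots> = (z ^ p) ^ (e * (p - 1))" by (simp add: power_mult[symmetric] mult_ac)
      finally show ?thesis using z by simp
    qed
    ultimately have "(\<eta> ^ p) ^ 2 = 1" by simp
    hence cases: "\<eta> ^ p = 1 \<or> \<eta> ^ p = -1" by (simp add: power2_eq_1_iff)
    have "\<eta> ^ p \<noteq> 1" using root_of_unity_in_K \<eta> by blast
    hence m1: "\<eta> ^ p = -1" using cases by simp
    show False
    proof (cases "p = 2")
      case False
      hence "odd p" using p primes_dvd_imp_eq two_is_prime_nat by blast
      hence "(- \<eta>) ^ p = 1" using m1 by simp
      hence "- \<eta> \<in> K" by (rule root_of_unity_in_K)
      thus False using subfield_uminus[OF K, of "- \<eta>"] \<eta> by simp
    next
      \<comment> \<open>Now \<open>\<eta> ^ 2 = -1\<close>. Either \<open>x ^ 2\<close> is in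
        \<open>K\<close> and \<open>\<xi>\<close> is a square root of 1, or \<open>K\<close> has a
        square root \<open>i\<close> of \<open>-1\<close> and \<open>\<eta>\<close> is
        \<open>i\<close> or \<open>- i\<close>. Both contradict the choice of elements outside
        \<open>K\<close>.\<close>
      case True
      show False
      proof (cases "x ^ 2 \<in> K")
        case sq: True
        hence "\<xi> ^ p = 1" using \<xi>_pow True by simp
        thus False using root_of_unity_in_K n by blast
      next
        case sq: False
        then obtain i where i: "i \<in> K" "i ^ 2 = -1" using two True by blast
        hence "\<eta> ^ 2 = i ^ 2" using m1 True by simp
        hence "\<eta> = i \<or> \<eta> = - i" by (simp add: power2_eq_iff)
        thus False using i \<eta> subfield_uminus[OF K] by auto
      qed
    qed
  qed
  \<comment> \<open>All conjugates of \<open>\<xi>\<close> coincide, so their product, which is 1,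
    is \<open>\<xi> ^ p\<close>.\<close>
  have "(\<sigma> ^^ j) \<xi> = \<xi>" for j by (induction j) (auto simp: \<sigma>_const[OF \<open>\<xi> \<in> K\<close>])
  hence "\<xi> ^ p = 1" using prod_conjugates_quotient[OF x(1,2)] unfolding \<xi>_def by simp
  then obtain e where e: "e < p" "\<xi> = z ^ e" using prime_root_of_unity_power[OF p z(2,3)] by blast
  define y where "y = x / a ^ e"
  have yL: "y \<in> L" and aL: "a \<in> L"
    unfolding y_def using x adjoin_contains[OF K] subfield_divide[OF L] subfield_power[OF L] by auto
  have xy: "x = y * a ^ e" unfolding y_def using a0 by simp
  have "\<sigma> x = \<sigma> y * (z * a) ^ e"
    using \<sigma>_mult[OF yL subfield_power[OF L aL]] \<sigma>_power[OF aL] \<sigma>_a xy by simp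
  moreover have "\<sigma> x = z ^ e * x" using e(2) x(2) unfolding \<xi>_def by (simp add: field_simps)
  ultimately have "\<sigma> y = y" using xy z0 a0 by (simp add: power_mult_distrib)
  hence "y \<in> K" using \<sigma>_fixed yL by blast
  thus ?thesis using xy e(1) by blast
qed

end

section \<open>Independence of radicals\<close>

text \<open>Families are indexed because factors of distinct elements may coincide, while one index
  set has to serve an element and both of its factors.\<close>

definition independent_family :: "'a::field set \<Rightarrow> 'i set \<Rightarrow> ('i \<Rightarrow> 'a) \<Rightarrow> bool" where
  "independent_family K I g \<longleftrightarrow>
     (\<forall>c. (\<forall>i\<in>I. c i \<in> K) \<and> (\<Sum>i\<in>I. c i * g i) = 0 \<longrightarrow> (\<forall>i\<in>I. c i = 0))"

definition inequivalent :: "'a::field set \<Rightarrow> 'i set \<Rightarrow> ('i \<Rightarrow> 'a) \<Rightarrow> bool" where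
  "inequivalent K I g \<longleftrightarrow> (\<forall>i\<in>I. \<forall>j\<in>I. i \<noteq> j \<longrightarrow> g i / g j \<notin> K)"

lemma independent_family_singleton:
  assumes "\<And>i j. i \<in> I \<Longrightarrow> j \<in> I \<Longrightarrow> i = j" "\<And>i. i \<in> I \<Longrightarrow> g i \<noteq> 0"
  shows "independent_family K I g"
proof -
  have "c i = 0" if "(\<Sum>i\<in>I. c i * g i) = 0" "i \<in> I" for c i
  proof -
    have "I = {i}" using assms(1) that(2) by blast
    thus ?thesis using that assms(2) by simp
  qed
  thus ?thesis unfolding independent_family_def by blast
qed

text \<open>Collecting the relation by classes modulo \<open>L\<close> leaves a relation between
  inequivalent representatives. These are independent by \<open>ind\<close>, so the part of the sum
  in each class vanishes.\<close>

lemma sum_over_coset_eq_0: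
  fixes h :: "'i \<Rightarrow> 'a::field"
  assumes L: "is_subfield L" and I: "finite I" and h0: "\<And>i. i \<in> I \<Longrightarrow> h i \<noteq> 0"
    and d: "\<And>i. i \<in> I \<Longrightarrow> d i \<in> L" and sum0: "(\<Sum>i\<in>I. d i * h i) = 0"
    and ind: "\<And>R. R \<subseteq> I \<Longrightarrow> inequivalent L R h \<Longrightarrow> independent_family L R h"
    and j: "j \<in> I"
  shows "(\<Sum>i\<in>{i\<in>I. h i / h j \<in> L}. d i * (h i / h j)) = 0"
proof -
  \<comment> \<open>Equivalent indices define the same predicate, hence \<open>SOME\<close> picks
    the same representative for them.\<close>
  define r where "r i = (SOME k. k \<in> I \<and> h k / h i \<in> L)" for i
  have r: "r i \<in> I \<and> h (r i) / h i \<in> L" if "i \<in> I" for i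
    unfolding r_def using someI[of "\<lambda>k. k \<in> I \<and> h k / h i \<in> L" i] that h0 subfield_1[OF L] by auto
  have r_eq: "r i = r i'" if "i \<in> I" "i' \<in> I" "h i / h i' \<in> L" for i i'
  proof -
    have "h k / h i \<in> L \<longleftrightarrow> h k / h i' \<in> L" for k
    proof
      assume "h k / h i \<in> L"
      hence "h k / h i * (h i / h i') \<in> L" using that(3) subfield_mult[OF L] by blast
      thus "h k / h i' \<in> L" using h0 that by simp
    next
      assume "h k / h i' \<in> L"
      hence "h k / h i' / (h i / h i') \<in> L" using that(3) subfield_divide[OF L] by blast
      thus "h k / h i \<in> L" using h0 that by simp
    qed
    thus ?thesis unfolding r_def by simp
  qed
  have r_same: "h i / h i' \<in> L" if "i \<in> I" "i' \<in> I" "r i = r i'" for i i'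
  proof -
    have "h (r i) / h i' / (h (r i) / h i) \<in> L" 
      using r[OF that(1)] r[OF that(2)] unfolding that(3)[symmetric] by (blast intro: subfield_divide[OF L])
    thus ?thesis using h0[OF that(1)] h0[OF that(2)] h0[of "r i"] r[OF that(1)] by simp
  qed
  have "inequivalent L (r ` I) h" unfolding inequivalent_def
  proof (intro ballI impI notI)
    fix s t assume "s \<in> r ` I" "t \<in> r ` I" and ne: "s \<noteq> t" and "h s / h t \<in> L"
    then obtain i i' where ii: "i \<in> I" "s = r i" "i' \<in> I" "t = r i'" by auto
    have "h s / h t * (h t / h i') / (h s / h i) \<in> L"
      using \<open>h s / h t \<in> L\<close> r[OF ii(1)] r[OF ii(3)] unfolding ii(2,4)
      by (intro subfield_divide[OF L subfield_mult[OF L]]) auto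
    hence "h i / h i' \<in> L" using h0[OF ii(1)] h0[OF ii(3)] h0[of s] h0[of t] r[OF ii(1)] r[OF ii(3)] ii by simp
    thus False using r_eq[OF ii(1,3)] ii(2,4) ne by simp
  qed
  moreover have "r ` I \<subseteq> I" using r by auto
  ultimately have "independent_family L (r ` I) h" by (rule ind[rotated])
  moreover define C where "C s = (\<Sum>i\<in>{i\<in>I. r i = s}. d i * (h i / h s))" for s
  have "C s \<in> L" if "s \<in> r ` I" for s
  proof -
    have "h i / h (r i) \<in> L" if "i \<in> I" for i
    proof -
      have "inverse (h (r i) / h i) \<in> L" using r[OF that] subfield_inverse[OF L] by blast
      thus ?thesis by (simp add: field_simps)
    qed
    thus ?thesis unfolding C_def using d
      by (auto intro!: subfield_sum[OF L] subfield_mult[OF L] simp del: times_divide_eq_right)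
  qed
  moreover have "(\<Sum>s\<in>r ` I. C s * h s) = 0"
  proof -
    have "(\<Sum>i\<in>I. d i * h i) = (\<Sum>s\<in>r ` I. \<Sum>i\<in>{i\<in>I. r i = s}. d i * h i)"
      using sum.image_gen[OF I, of "\<lambda>i. d i * h i" r] by simp
    also have "\<dots> = (\<Sum>s\<in>r ` I. C s * h s)"
      unfolding C_def sum_distrib_right using h0 r by (intro sum.cong) auto
    finally show ?thesis using sum0 by simp
  qed
  ultimately have C0: "C (r j) = 0" unfolding independent_family_def using j by blast
  have "{i\<in>I. h i / h j \<in> L} = {i\<in>I. r i = r j}" using r_eq r_same j by blast
  hence "(\<Sum>i\<in>{i\<in>I. h i / h j \<in> L}. d i * (h i / h j)) = C (r j) * (h (r j) / h j)"
    unfolding C_def sum_distrib_right using h0 r j by (intro sum.cong) auto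
  thus ?thesis using C0 by simp
qed

text \<open>The induction adjoins one \<open>p\<close>-th root \<open>a\<close> at a time; the family collapses to
  representatives modulo \<open>K(a)\<close>, and inside a class only multiples of powers of \<open>a\<close> occur.\<close>

lemma p_radicals_independent:
  fixes h :: "'i \<Rightarrow> 'a::field"
  assumes p: "prime p" and z: "z ^ p = 1" "z \<noteq> 1"
  shows "is_subfield K \<Longrightarrow> z \<in> K \<Longrightarrow> finite I \<Longrightarrow> (\<And>i. i \<in> I \<Longrightarrow> h i \<noteq> 0) \<Longrightarrow> inequivalent K I h \<Longrightarrow>
    (\<And>i j. i \<in> I \<Longrightarrow> j \<in> I \<Longrightarrow> (h i / h j) ^ (p ^ M) \<in> K) \<Longrightarrow>
    (p = 2 \<Longrightarrow> (\<exists>x\<in>K. x ^ 2 = -1) \<or> (\<forall>i\<in>I. \<forall>j\<in>I. (h i / h j) ^ 2 \<in> K)) \<Longrightarrow>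
    independent_family K I h"
\<comment> \<open>The measure counts the \<open>p\<close>-powers of quotients that still lie outside
  the field. It is finite because \<open>m < M\<close>, and it drops when one such power is
  adjoined.\<close>
proof (induction "card {(i, j, m). i \<in> I \<and> j \<in> I \<and> m < M \<and> (h i / h j) ^ (p ^ m) \<notin> K}"
    arbitrary: K I rule: less_induct)
  case less
  note K = less.prems(1) and two = less.prems(7)
  let ?D = "\<lambda>K I. {(i, j, m). i \<in> I \<and> j \<in> I \<and> m < M \<and> (h i / h j) ^ (p ^ m) \<notin> K}"
  show ?case
  proof (cases "\<exists>i\<in>I. \<exists>j\<in>I. i \<noteq> j")
    case False
    thus ?thesis using independent_family_singleton[of I h K] less.prems(4) by blast
  next
    case True
    then obtain i0 j0 where ij: "i0 \<in> I" "j0 \<in> I" "i0 \<noteq> j0" by blast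
    let ?x = "h i0 / h j0"
    have "?x \<notin> K" using less.prems(5) ij unfolding inequivalent_def by blast
    then obtain u where u: "u < M" "?x ^ (p ^ u) \<notin> K" "?x ^ (p ^ Suc u) \<in> K"
      using ex_step_to_True[of "\<lambda>u. ?x ^ (p ^ u) \<in> K" M] less.prems(6)[OF ij(1,2)] by auto
    \<comment> \<open>The last \<open>p\<close>-power of \<open>?x\<close> outside \<open>K\<close>;
      adjoining it removes the triple \<open>(i0, j0, u)\<close> from the measure.\<close>
    define a where "a = ?x ^ (p ^ u)"
    interpret kummer K p z a
    proof
      show "a ^ p \<in> K" using u(3) unfolding a_def by (simp add: power_mult[symmetric] mult.commute)
    qed (use K p z less.prems(2) u a_def in auto)
    have KL: "K \<subseteq> L" using subset_adjoin[OF K] .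
    have ind: "independent_family L R h" if R: "R \<subseteq> I" "inequivalent L R h" for R
    proof (rule less.hyps)
      have "?D L R \<subseteq> ?D K I" using R KL by auto
      moreover have "(i0, j0, u) \<in> ?D K I" "(i0, j0, u) \<notin> ?D L R"
        using u ij adjoin_contains[OF K, of a] unfolding a_def by auto
      ultimately have "?D L R \<subset> ?D K I" by blast
      moreover have "?D K I \<subseteq> I \<times> I \<times> {..<M}" by auto
      hence "finite (?D K I)" by (rule finite_subset) (use less.prems(3) in auto)
      ultimately show "card (?D L R) < card (?D K I)" by (rule psubset_card_mono[rotated])
      show "(\<exists>x\<in>L. x ^ 2 = -1) \<or> (\<forall>i\<in>R. \<forall>j\<in>R. (h i / h j) ^ 2 \<in> L)" if "p = 2"
        using two[OF that] KL R(1) by blast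
      show "finite R" using R less.prems(3) finite_subset by blast
      show "(h i / h j) ^ (p ^ M) \<in> L" if "i \<in> R" "j \<in> R" for i j
        using less.prems(6)[of i j] KL R(1) that by blast
    qed (use L KL less.prems(2,4) R in auto)
    show ?thesis unfolding independent_family_def
    proof (intro allI impI ballI)
      fix c j assume c: "(\<forall>i\<in>I. c i \<in> K) \<and> (\<Sum>i\<in>I. c i * h i) = 0" and j: "j \<in> I"
      define J where "J = {i\<in>I. h i / h j \<in> L}"
      have sum0: "(\<Sum>i\<in>J. c i * (h i / h j)) = 0" unfolding J_def
        by (rule sum_over_coset_eq_0[OF L less.prems(3)]) (use less.prems(4) c KL ind j in auto)
      have "\<exists>k e. k \<in> K \<and> e < p \<and> h i / h j = k * a ^ e" if "i \<in> J" for i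
      proof -
        have i: "i \<in> I" "h i / h j \<in> L" using that unfolding J_def by auto
        have "h i / h j \<noteq> 0" using i j less.prems(4) by simp
        moreover have "(\<exists>x\<in>K. x ^ 2 = -1) \<or> (h i / h j) ^ 2 \<in> K" if "p = 2"
          using two[OF that] i j by blast
        ultimately show ?thesis using radical_in_L[OF i(2) _ less.prems(6)[OF i(1) j]] by blast
      qed
      then obtain k e where ke: "\<And>i. i \<in> J \<Longrightarrow> k i \<in> K \<and> e i < p \<and> h i / h j = k i * a ^ e i"
        by metis
      have nz: "h i \<noteq> 0" if "i \<in> J" for i using less.prems(4) that unfolding J_def by auto
      have hj: "h j \<noteq> 0" using less.prems(4) j by auto
      \<comment> \<open>Equal exponents would make a quotient of two members an element of
        \<open>K\<close>, against inequivalence.\<close>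
      have "inj_on e J"
      proof (rule inj_onI, rule ccontr)
        fix i i' assume ii: "i \<in> J" "i' \<in> J" "e i = e i'" "i \<noteq> i'"
        have "h i / h i' = (h i / h j) / (h i' / h j)" using hj by simp
        also have "\<dots> = k i / k i'" using ke[OF ii(1)] ke[OF ii(2)] ii(3) a0 by simp
        finally have "h i / h i' \<in> K" using ke ii subfield_divide[OF K] by metis
        thus False using less.prems(5) ii unfolding inequivalent_def J_def by blast
      qed
      moreover have "(\<Sum>i\<in>J. c i * k i * a ^ e i) = 0"
        using sum0 ke by (simp add: mult.assoc)
      moreover have jJ: "j \<in> J" unfolding J_def using j hj subfield_1[OF L] by simp
      moreover have "finite J" unfolding J_def using less.prems(3) by simp
      ultimately have "c j * k j = 0"
        using power_basis_independent[of J "\<lambda>i. c i * k i" e j] ke c subfield_mult[OF K]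
        unfolding J_def by blast
      moreover have "k j \<noteq> 0" using ke[OF jJ] hj by auto
      ultimately show "c j = 0" by simp
    qed
  qed
qed

section \<open>Extensions of degree prime to \<open>p\<close>\<close>

lemma adjoin_root_small_degree:
  assumes E: "is_subfield E" and f: "poly_over E f" "f \<noteq> 0" "poly f y = 0" and d: "degree f < p"
    and p: "prime p"
  obtains F d where "is_subfield F" "E \<subseteq> F" "y \<in> F" "has_norm E F d" "coprime d p"
proof -
  obtain m where m: "poly_over E m" "m \<noteq> 0" "poly m y = 0"
    "\<And>q. poly_over E q \<Longrightarrow> poly q y = 0 \<Longrightarrow> degree q < degree m \<Longrightarrow> q = 0"
    "degree m \<le> degree f" "degree m > 0"
    using minimal_poly_exists[OF E f] by metis
  \<comment> \<open>The degree is positive and smaller than the prime \<open>p\<close>.\<close>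
  have "coprime (degree m) p"
    using p d m(5,6) by (metis coprime_commute dvd_imp_le leD le_less_trans prime_imp_coprime_nat)
  thus ?thesis
    using that is_subfield_adjoin[OF E f] subset_adjoin[OF E] adjoin_contains[OF E]
      adjoin_has_norm[OF E m(1-4,6)] by blast
qed

text \<open>One prime \<open>q\<close> of \<open>m = q * k\<close> is removed at a time:
  \<open>y ^ k\<close> is a root of a polynomial of degree \<open>q < p\<close>, and over the field
  so obtained \<open>y\<close> is a \<open>k\<close>-th root. Degrees prime to \<open>p\<close>
  multiply along the tower.\<close>

lemma adjoin_radical:
  assumes p: "prime p"
  shows "is_subfield E \<Longrightarrow> m > 0 \<Longrightarrow> (\<And>q. prime q \<Longrightarrow> q dvd m \<Longrightarrow> q < p) \<Longrightarrow> y ^ m \<in> E \<Longrightarrow>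
    \<exists>F d. is_subfield F \<and> E \<subseteq> F \<and> y \<in> F \<and> has_norm E F d \<and> coprime d p"
proof (induction m arbitrary: E rule: less_induct)
  case (less m)
  show ?case
  proof (cases "m = 1")
    case True
    thus ?thesis using less.prems by (intro exI[of _ E] exI[of _ 1]) (auto simp: has_norm_def)
  next
    case False
    then obtain q where q: "prime q" "q dvd m" using prime_factor_nat by blast
    then obtain k where k: "m = q * k" by auto
    have k0: "k > 0" "k < m" using less.prems(2) k q prime_gt_1_nat[OF q(1)] by auto
    define f where "f = monom 1 q - [:y ^ m:]"
    note f = radical_poly[OF less.prems(1) prime_gt_0_nat[OF q(1)] less.prems(4), folded f_def]
    have "poly f (y ^ k) = 0"
      unfolding f_def using k by (simp add: poly_monom power_mult[symmetric] mult.commute)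
    moreover have "degree f < p" using f(3) less.prems(3) q by simp
    ultimately obtain F d where F: "is_subfield F" "E \<subseteq> F" "y ^ k \<in> F" "has_norm E F d" "coprime d p"
      using adjoin_root_small_degree[OF less.prems(1) f(1,2) _ _ p] by metis
    have "\<And>r. prime r \<Longrightarrow> r dvd k \<Longrightarrow> r < p" using less.prems(3) k by auto
    then obtain F' d' where F': "is_subfield F'" "F \<subseteq> F'" "y \<in> F'" "has_norm F F' d'" "coprime d' p"
      using less.IH[OF k0(2) F(1) k0(1) _ F(3)] by blast
    have "has_norm E F' (d * d')" using has_norm_trans[OF less.prems(1) F(4) F'(4) F(2)] .
    thus ?thesis using F F' by (intro exI[of _ F'] exI[of _ "d * d'"]) auto
  qed
qed

lemma adjoin_radicals:
  assumes p: "prime p" and E: "is_subfield E" and m: "m > 0" "\<And>q. prime q \<Longrightarrow> q dvd m \<Longrightarrow> q < p"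
    and I: "finite I" "\<And>i. i \<in> I \<Longrightarrow> l i ^ m \<in> E"
  shows "\<exists>F d. is_subfield F \<and> E \<subseteq> F \<and> l ` I \<subseteq> F \<and> has_norm E F d \<and> coprime d p"
  using I
proof (induction I rule: finite_induct)
  case empty
  thus ?case using E by (intro exI[of _ E] exI[of _ 1]) (auto simp: has_norm_def)
next
  case (insert i I)
  then obtain F d where F: "is_subfield F" "E \<subseteq> F" "l ` I \<subseteq> F" "has_norm E F d" "coprime d p" by blast
  have "l i ^ m \<in> F" using insert.prems F(2) by blast
  then obtain F' d' where F': "is_subfield F'" "F \<subseteq> F'" "l i \<in> F'" "has_norm F F' d'" "coprime d' p"
    using adjoin_radical[OF p F(1) m(1) m(2)] by blast
  have "has_norm E F' (d * d')" using has_norm_trans[OF E F(4) F'(4) F(2)] .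
  thus ?case using F F' by (intro exI[of _ F'] exI[of _ "d * d'"]) auto
qed

text \<open>A root of \<open>1 + X + ... + X^(p-1)\<close> is taken. It differs from 1 because the
  value at 1 is \<open>p\<close>, which is nonzero in the field, and the degree \<open>p - 1\<close>
  is below \<open>p\<close>.\<close>

lemma adjoin_prime_root_of_unity:
  fixes E :: "'a::alg_closed_field set"
  assumes p: "prime p" "of_nat p \<noteq> (0::'a)" and E: "is_subfield E"
  shows "\<exists>z F d. z ^ p = 1 \<and> z \<noteq> 1 \<and> is_subfield F \<and> E \<subseteq> F \<and> z \<in> F \<and> has_norm E F d \<and> coprime d p"
proof -
  define f where "f = (\<Sum>i<p. monom (1::'a) i)"
  have co: "coeff f j = (if j < p then 1 else 0)" for j
    unfolding f_def by (simp add: coeff_sum)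
  have "degree f < p" using prime_gt_0_nat[OF p(1)] by (intro degree_lessI) (auto simp: co)
  moreover have "degree f \<ge> p - 1" using prime_gt_0_nat[OF p(1)] by (intro le_degree) (auto simp: co)
  ultimately have deg: "degree f < p" "degree f > 0" using prime_gt_1_nat[OF p(1)] by auto
  then obtain z where z: "poly f z = 0" using alg_closed_imp_poly_has_root by blast
  have pf: "poly f x = (\<Sum>i<p. x ^ i)" for x unfolding f_def by (simp add: poly_sum poly_monom)
  have "z \<noteq> 1" using z p(2) pf by auto
  moreover have "z ^ p = 1" using z pf[of z] power_diff_1_eq[of z p] by simp
  moreover have "poly_over E f" unfolding poly_over_def co using subfield_0[OF E] subfield_1[OF E] by auto
  moreover have "f \<noteq> 0" using deg by auto
  ultimately show ?thesis using adjoin_root_small_degree[OF E _ _ z deg(1) p(1)] by metis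
qed

context
  fixes G :: "'a::field set"
  assumes G: "is_mult_subgroup G"
begin

lemma mult_subgroup_nonzero: "x \<in> G \<Longrightarrow> x \<noteq> 0"
  and mult_subgroup_1: "1 \<in> G"
  and mult_subgroup_mult: "x \<in> G \<Longrightarrow> y \<in> G \<Longrightarrow> x * y \<in> G"
  and mult_subgroup_inverse: "x \<in> G \<Longrightarrow> inverse x \<in> G"
  using G unfolding is_mult_subgroup_def by auto

lemma mult_subgroup_divide: "x \<in> G \<Longrightarrow> y \<in> G \<Longrightarrow> x / y \<in> G"
  by (simp add: divide_inverse mult_subgroup_mult mult_subgroup_inverse)

lemma mult_subgroup_power: "x \<in> G \<Longrightarrow> x ^ n \<in> G"
  by (induction n) (auto simp: mult_subgroup_1 mult_subgroup_mult)

end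

text \<open>The field being algebraically closed supplies \<open>p\<close>-th roots of unity. Only
  those in \<open>G\<close> are assumed to lie in \<open>K\<close>. The conditions on primes speak
  of divisors of \<open>n\<close> and are thus inherited by the smaller exponent.\<close>

lemma radicals_independent_alg_closed:
  fixes K G :: "'a::alg_closed_field set" and g :: "'i \<Rightarrow> 'a"
  assumes K: "is_subfield K" and G: "is_mult_subgroup G" and KG: "K - {0} \<subseteq> G"
    and four: "(\<exists>x\<in>K. x ^ 2 = -1) \<or> (\<forall>w\<in>G. w ^ 4 \<in> K \<longrightarrow> w ^ 2 \<in> K)"
  shows "n > 0 \<Longrightarrow> finite I \<Longrightarrow> (\<And>i. i \<in> I \<Longrightarrow> g i \<in> G) \<Longrightarrow> (\<And>i. i \<in> I \<Longrightarrow> g i ^ n \<in> K) \<Longrightarrow>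
    inequivalent K I g \<Longrightarrow> (\<And>p. prime p \<Longrightarrow> p dvd n \<Longrightarrow> of_nat p \<noteq> (0::'a)) \<Longrightarrow>
    (\<And>p w. prime p \<Longrightarrow> p dvd n \<Longrightarrow> w \<in> G \<Longrightarrow> w ^ p = 1 \<Longrightarrow> w \<in> K) \<Longrightarrow>
    independent_family K I g"
proof (induction n arbitrary: I g rule: less_induct)
  case (less n)
  note gG = less.prems(3) and gn = less.prems(4) and char = less.prems(6) and roots = less.prems(7)
  show ?case
  proof (cases "n = 1")
    case True
    have "i = j" if "i \<in> I" "j \<in> I" for i j
    proof (rule ccontr)
      assume "i \<noteq> j"
      moreover have "g i / g j \<in> K" using gn that True subfield_divide[OF K] by simp
      ultimately show False using less.prems(5) that unfolding inequivalent_def by blast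
    qed
    thus ?thesis using independent_family_singleton mult_subgroup_nonzero[OF G] gG by blast
  next
    case False
    \<comment> \<open>With the largest prime, all primes of the cofactor \<open>m\<close> are below
      \<open>p\<close>, as \<open>adjoin_radicals\<close> requires.\<close>
    define p where "p = Max {p. prime p \<and> p dvd n}"
    have fin: "finite {p. prime p \<and> p dvd n}"
      using less.prems(1) by (intro finite_subset[OF _ finite_atMost[of n]]) (auto dest: dvd_imp_le)
    have "{p. prime p \<and> p dvd n} \<noteq> {}" using prime_factor_nat[OF False] by blast
    hence "p \<in> {p. prime p \<and> p dvd n}" unfolding p_def by (rule Max_in[OF fin])
    hence p: "prime p" "p dvd n" by auto
    have p_max: "q \<le> p" if "prime q" "q dvd n" for q unfolding p_def using fin that by (intro Max_ge) auto
    obtain k m where km: "\<not> p dvd m" "n = m * p ^ k" using prime_power_canonical[OF p(1) less.prems(1)] by blast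
    have k0: "k > 0" using km p(2) by (cases k) auto
    have m0: "m > 0" using km(2) less.prems(1) by auto
    have "1 < p ^ k" using one_less_power[OF prime_gt_1_nat[OF p(1)] k0] .
    hence mn: "m < n" using km(2) m0 by simp
    have m_primes: "q < p" if "prime q" "q dvd m" for q
      using p_max[of q] that km by (metis dvd_mult2 le_neq_implies_less)
    have "coprime (p ^ k) m" using km(1) p(1) by (simp add: prime_imp_coprime_nat)
    \<comment> \<open>Bezout splits \<open>g i\<close> into \<open>l i\<close>, whose
      \<open>m\<close>-th power is in \<open>K\<close>, and \<open>h i\<close>, whose
      \<open>p ^ k\<close>-th power is in \<open>K\<close>.\<close>
    then obtain x y where xy: "p ^ k * x = m * y + 1"
      using bezout_nat[of "p ^ k" m] prime_gt_0_nat[OF p(1)] by auto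
    define l where "l i = g i ^ (p ^ k * x)" for i
    define h where "h i = inverse (g i ^ (m * y))" for i
    have g0: "g i \<noteq> 0" if "i \<in> I" for i using mult_subgroup_nonzero[OF G gG[OF that]] .
    have g_split: "g i = l i * h i" if "i \<in> I" for i
      unfolding l_def h_def xy using g0[OF that] by (simp add: power_add)
    have hG: "h i \<in> G" if "i \<in> I" for i
      unfolding h_def using mult_subgroup_inverse[OF G] mult_subgroup_power[OF G] gG that by blast
    have h0: "h i \<noteq> 0" if "i \<in> I" for i using mult_subgroup_nonzero[OF G hG[OF that]] .
    have lG: "l i \<in> G" if "i \<in> I" for i unfolding l_def using mult_subgroup_power[OF G] gG that by blast
    have lm: "l i ^ m \<in> K" if "i \<in> I" for i
    proof -
      have "l i ^ m = (g i ^ n) ^ x" unfolding l_def km(2) by (simp add: power_mult[symmetric] mult_ac)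
      thus ?thesis using gn[OF that] subfield_power[OF K] by simp
    qed
    have hk: "h i ^ (p ^ k) \<in> K" if "i \<in> I" for i
    proof -
      have "h i ^ (p ^ k) = inverse ((g i ^ n) ^ y)"
        unfolding h_def km(2) by (simp add: power_mult[symmetric] power_inverse mult_ac)
      thus ?thesis using gn[OF that] subfield_power[OF K] subfield_inverse[OF K] by simp
    qed
    have hhk: "(h i / h j) ^ (p ^ k) \<in> K" if "i \<in> I" "j \<in> I" for i j
      using subfield_divide[OF K hk[OF that(1)] hk[OF that(2)]] by (simp add: power_divide)

    obtain z E d where E: "z ^ p = 1" "z \<noteq> 1" "is_subfield E" "K \<subseteq> E" "z \<in> E" "has_norm K E d" "coprime d p"
      using adjoin_prime_root_of_unity[OF p(1) char[OF p] K] by blast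
    obtain F d' where F: "is_subfield F" "E \<subseteq> F" "l ` I \<subseteq> F" "has_norm E F d'" "coprime d' p"
      using adjoin_radicals[OF p(1) E(3) m0 m_primes less.prems(2), of l] lm E(4) by blast
    define D where "D = d * d'"
    have norm: "has_norm K F D" "coprime D p" and KF: "K \<subseteq> F"
      unfolding D_def using has_norm_trans[OF K E(6) F(4) E(4)] E F by auto
    have D0: "D \<noteq> 0" using norm(2) p(1) by (intro notI) simp

    \<comment> \<open>With \<open>b\<close> the last \<open>p\<close>-power of \<open>w\<close>
      outside \<open>K\<close> and \<open>c\<close> its norm from \<open>F\<close>, the element
      \<open>b ^ D / c\<close> of \<open>G\<close> is a \<open>p\<close>-th root of unity, hence in
      \<open>K\<close>. So \<open>b ^ D\<close> is in \<open>K\<close>, and \<open>D\<close> is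
      prime to \<open>p\<close>.\<close>
    have descend: "w \<in> K" if w: "w \<in> G" "w \<in> F" "w ^ (p ^ k) \<in> K" for w
    proof (rule ccontr)
      assume "w \<notin> K"
      then obtain u where u: "w ^ (p ^ u) \<notin> K" "w ^ (p ^ Suc u) \<in> K"
        using ex_step_to_True[of "\<lambda>u. w ^ (p ^ u) \<in> K" k] w(3) by auto
      define b where "b = w ^ (p ^ u)"
      have b: "b \<notin> K" "b ^ p \<in> K" "b \<in> G" "b \<in> F" "b \<noteq> 0"
        using u w subfield_power[OF F(1)] mult_subgroup_power[OF G] mult_subgroup_nonzero[OF G] unfolding b_def
        by (auto simp: power_mult[symmetric] mult.commute)
      obtain c where c: "c \<in> K" "c ^ p = (b ^ p) ^ D"
        using has_norm_root[OF K F(1) KF norm(1) b(4,2)] by blast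
      have c0: "c \<noteq> 0" using c(2) b(5) prime_gt_0_nat[OF p(1)] by (auto simp: power_0_left)
      have "b ^ D / c \<in> G"
        using mult_subgroup_divide[OF G mult_subgroup_power[OF G b(3)]] KG c c0 by blast
      moreover have "(b ^ D / c) ^ p = 1"
        using c c0 b(5) by (simp add: power_divide power_mult[symmetric] mult.commute)
      ultimately have "b ^ D / c * c \<in> K" using roots[OF p] c(1) subfield_mult[OF K] by blast
      hence "b ^ D \<in> K" using c0 by simp
      thus False using coprime_power_in_subfield[OF K b(2) _ norm(2) D0] b(1) by blast
    qed

    have ind: "independent_family F R h" if R: "R \<subseteq> I" "inequivalent F R h" for R
    proof (rule p_radicals_independent[OF p(1) E(1,2) F(1) _ _ _ R(2), where M = k])
      show "(\<exists>x\<in>F. x ^ 2 = -1) \<or> (\<forall>i\<in>R. \<forall>j\<in>R. (h i / h j) ^ 2 \<in> F)" if "p = 2"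
        using four
      proof
        assume sq: "\<forall>w\<in>G. w ^ 4 \<in> K \<longrightarrow> w ^ 2 \<in> K"
        \<comment> \<open>The exponent \<open>2 ^ j\<close> is halved repeatedly, applying
          \<open>sq\<close> to the power of \<open>w\<close> whose fourth power is known to be in
          \<open>K\<close>.\<close>
        have step: "w ^ 2 \<in> K" if "w \<in> G" "w ^ (2 ^ j) \<in> K" for w j
          using that(2)
        proof (induction j)
          case 0 thus ?case using subfield_power[OF K] by simp
        next
          case (Suc j)
          show ?case
          proof (cases j)
            case 0 thus ?thesis using Suc by simp
          next
            case (Suc i)
            have "(w ^ (2 ^ i)) ^ 4 \<in> K" using Suc.prems Suc by (simp add: power_mult[symmetric] mult.commute)
            hence "(w ^ (2 ^ i)) ^ 2 \<in> K" using sq mult_subgroup_power[OF G that(1)] by blast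
            thus ?thesis using Suc.IH Suc by (simp add: power_mult[symmetric] mult.commute)
          qed
        qed
        have "(h i / h j) ^ 2 \<in> F" if "i \<in> R" "j \<in> R" for i j
          using step[of "h i / h j" k] hhk[of i j] mult_subgroup_divide[OF G hG hG, of i j] that R(1) KF \<open>p = 2\<close>
          by blast
        thus ?thesis by blast
      qed (use KF in blast)
      show "finite R" using R less.prems(2) finite_subset by blast
    qed (use E F hhk KF h0 R in blast)+

    show ?thesis unfolding independent_family_def
    proof (intro allI impI ballI)
      fix c j assume c: "(\<forall>i\<in>I. c i \<in> K) \<and> (\<Sum>i\<in>I. c i * g i) = 0" and j: "j \<in> I"
      define J where "J = {i\<in>I. h i / h j \<in> F}"
      have "(\<Sum>i\<in>I. c i * l i * h i) = 0" using c g_split by (simp add: mult.assoc)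
      hence "(\<Sum>i\<in>J. c i * l i * (h i / h j)) = 0" unfolding J_def
        by (intro sum_over_coset_eq_0[OF F(1) less.prems(2) h0 _ _ ind j])
          (use c KF F(3) in \<open>auto intro!: subfield_mult[OF F(1)]\<close>)
      hence sum0: "(\<Sum>i\<in>J. c i * (h i / h j) * l i) = 0" by (simp add: mult_ac)
      \<comment> \<open>The class of \<open>j\<close> modulo \<open>F\<close> is already its class
        modulo \<open>K\<close>, so the sum becomes a relation over \<open>K\<close> between the
        \<open>l i\<close>.\<close>
      have hh: "h i / h j \<in> K" if "i \<in> J" for i
        using that descend[of "h i / h j"] hhk[of i j] j mult_subgroup_divide[OF G hG hG] unfolding J_def by blast
      hence cK: "c i * (h i / h j) \<in> K" if "i \<in> J" for i
        using that c subfield_mult[OF K] unfolding J_def by blast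
      \<comment> \<open>Within \<open>J\<close> the quotients of the \<open>h i\<close> are in
        \<open>K\<close>, so inequivalence of the \<open>g i\<close> passes to the
        \<open>l i\<close>.\<close>
      have "independent_family K J l"
      proof (rule less.IH[OF mn m0])
        show "inequivalent K J l" unfolding inequivalent_def
        proof (intro ballI impI notI)
          fix s t assume st: "s \<in> J" "t \<in> J" "s \<noteq> t" "l s / l t \<in> K"
          have I: "s \<in> I" "t \<in> I" using st unfolding J_def by auto
          have "l s / l t * ((h s / h j) / (h t / h j)) \<in> K"
            using st hh subfield_mult[OF K] subfield_divide[OF K] by blast
          hence "g s / g t \<in> K" using g_split I h0[OF j] by simp
          thus False using less.prems(5) I st(3) unfolding inequivalent_def by blast
        qed
        show "finite J" unfolding J_def using less.prems(2) by simp
        show "of_nat q \<noteq> (0::'a)" if "prime q" "q dvd m" for q using char that km(2) by auto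
        show "w \<in> K" if "prime q" "q dvd m" "w \<in> G" "w ^ q = 1" for q w using roots that km(2) by auto
      qed (use lG lm J_def in auto)
      moreover have jJ: "j \<in> J" unfolding J_def using j h0[OF j] subfield_1[OF F(1)] by simp
      ultimately have "c j * (h j / h j) = 0"
        unfolding independent_family_def using sum0 cK by (elim allE[of _ "\<lambda>i. c i * (h i / h j)"]) blast
      thus "c j = 0" using h0[OF j] by simp
    qed
  qed
qed

section \<open>Transfer to the algebraic closure\<close>

lemma is_subfield_to_ac:
  assumes K: "is_subfield K" shows "is_subfield (to_ac ` K)"
proof -
  have "0 \<in> to_ac ` K" "1 \<in> to_ac ` K"
    using subfield_0[OF K] subfield_1[OF K] by (metis imageI to_ac_0, metis imageI to_ac_1)
  moreover have "to_ac x + to_ac y \<in> to_ac ` K" "to_ac x * to_ac y \<in> to_ac ` K"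
    "- to_ac x \<in> to_ac ` K" "inverse (to_ac x) \<in> to_ac ` K" if "x \<in> K" "y \<in> K" for x y
    using that subfield_closed[OF K]
    by (auto simp flip: to_ac_add to_ac_mult to_ac_minus to_ac_inverse)
  ultimately show ?thesis unfolding is_subfield_def by auto
qed

lemma is_mult_subgroup_to_ac:
  assumes G: "is_mult_subgroup G" shows "is_mult_subgroup (to_ac ` G)"
proof -
  have "1 \<in> to_ac ` G" using mult_subgroup_1[OF G] by (metis imageI to_ac_1)
  moreover have "to_ac x * to_ac y \<in> to_ac ` G" "inverse (to_ac x) \<in> to_ac ` G"
    if "x \<in> G" "y \<in> G" for x y
    using that mult_subgroup_mult[OF G] mult_subgroup_inverse[OF G]
    by (auto simp flip: to_ac_mult to_ac_inverse)
  ultimately show ?thesis unfolding is_mult_subgroup_def using mult_subgroup_nonzero[OF G] by auto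
qed

lemma to_ac_power_in_image: "to_ac x ^ n \<in> to_ac ` K \<longleftrightarrow> x ^ n \<in> K"
  using inj_image_mem_iff[OF inj_to_ac, of "x ^ n" K] by simp

text \<open>Every hypothesis concerns only elements of \<open>K\<close> and \<open>G\<close>, so it
  survives the injective homomorphism \<open>to_ac\<close>; no new root of unity enters the image of
  \<open>G\<close>.\<close>

lemma radicals_independent:
  fixes K G :: "'a::field set" and g :: "'i \<Rightarrow> 'a"
  assumes K: "is_subfield K" and G: "is_mult_subgroup G" and KG: "K - {0} \<subseteq> G"
    and four: "(\<exists>x\<in>K. x ^ 2 = -1) \<or> (\<forall>w\<in>G. w ^ 4 \<in> K \<longrightarrow> w ^ 2 \<in> K)"
    and n: "n > 0" and I: "finite I" and g: "\<And>i. i \<in> I \<Longrightarrow> g i \<in> G" "\<And>i. i \<in> I \<Longrightarrow> g i ^ n \<in> K"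
    "inequivalent K I g"
    and char: "\<And>p. prime p \<Longrightarrow> p dvd n \<Longrightarrow> of_nat p \<noteq> (0::'a)"
    and roots: "\<And>p w. prime p \<Longrightarrow> p dvd n \<Longrightarrow> w \<in> G \<Longrightarrow> w ^ p = 1 \<Longrightarrow> w \<in> K"
  shows "independent_family K I g"
proof -
  have "independent_family (to_ac ` K) I (\<lambda>i. to_ac (g i))"
  proof (rule radicals_independent_alg_closed[OF is_subfield_to_ac[OF K] is_mult_subgroup_to_ac[OF G] _ _ n I])
    show "to_ac ` K - {0} \<subseteq> to_ac ` G" using KG by auto
    show "(\<exists>x\<in>to_ac ` K. x ^ 2 = -1) \<or> (\<forall>w\<in>to_ac ` G. w ^ 4 \<in> to_ac ` K \<longrightarrow> w ^ 2 \<in> to_ac ` K)"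
      using four
    proof
      assume "\<exists>x\<in>K. x ^ 2 = -1"
      then obtain x where "x \<in> K" "x ^ 2 = -1" by blast
      hence "to_ac x ^ 2 = -1" by (metis to_ac_power to_ac_minus to_ac_1)
      thus ?thesis using \<open>x \<in> K\<close> by blast
    qed (auto simp: to_ac_power_in_image)
    show "to_ac (g i) \<in> to_ac ` G" "to_ac (g i) ^ n \<in> to_ac ` K" if "i \<in> I" for i
      using g that by (auto simp: to_ac_power_in_image)
    show "inequivalent (to_ac ` K) I (\<lambda>i. to_ac (g i))"
      using g(3) inj_image_mem_iff[OF inj_to_ac] unfolding inequivalent_def
      by (auto simp flip: to_ac_divide)
    show "of_nat p \<noteq> (0 :: 'a alg_closure)" if "prime p" "p dvd n" for p
      using char[OF that] to_ac_of_nat[of p] by (metis to_ac_eq_0_iff)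
    show "w \<in> to_ac ` K" if p: "prime p" "p dvd n" and w: "w \<in> to_ac ` G" "w ^ p = 1" for p w
    proof -
      obtain v where v: "v \<in> G" "w = to_ac v" using w by auto
      hence "to_ac (v ^ p) = to_ac 1" using w by simp
      hence "v ^ p = 1" by (simp only: to_ac_eq_iff)
      thus ?thesis using roots[OF p v(1)] v by blast
    qed
  qed
  hence *: "\<forall>i\<in>I. c i = 0" if "\<forall>i\<in>I. c i \<in> to_ac ` K" "(\<Sum>i\<in>I. c i * to_ac (g i)) = 0" for c
    using that unfolding independent_family_def by blast
  show ?thesis unfolding independent_family_def
  proof (intro allI impI)
    fix c assume c: "(\<forall>i\<in>I. c i \<in> K) \<and> (\<Sum>i\<in>I. c i * g i) = 0"
    have "(\<Sum>i\<in>I. to_ac (c i) * to_ac (g i)) = to_ac (\<Sum>i\<in>I. c i * g i)" by (simp add: to_ac_sum)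
    hence "\<forall>i\<in>I. to_ac (c i) = 0" using c by (intro *) auto
    thus "\<forall>i\<in>I. c i = 0" by simp
  qed
qed

section \<open>Transversals\<close>

lemma coset_order:
  assumes "\<exists>n>0. g ^ n \<in> K"
  shows "coset_order K g > 0" "g ^ coset_order K g \<in> K"
  using LeastI_ex[of "\<lambda>n. n > 0 \<and> g ^ n \<in> K"] assms unfolding coset_order_def by auto

text \<open>This converts the hypothesis on elements of order 4 into one on squares. Exponent 3 is
  impossible because \<open>w ^ 4 / w ^ 3\<close> would put \<open>w\<close>, and so
  \<open>w ^ 2\<close>, into \<open>K\<close>.\<close>

lemma coset_order_eq_4:
  assumes K: "is_subfield K" and w: "w \<noteq> 0" "w ^ 4 \<in> K" "w ^ 2 \<notin> K"
  shows "coset_order K w = 4"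
proof -
  have "(LEAST n. n > 0 \<and> w ^ n \<in> K) = 4"
  proof (rule Least_equality)
    show "0 < (4::nat) \<and> w ^ 4 \<in> K" using w by simp
  next
    fix n assume n: "n > 0 \<and> w ^ n \<in> K"
    have "w \<notin> K" using w(3) subfield_power[OF K] by blast
    moreover have "w ^ 3 \<notin> K"
    proof
      assume "w ^ 3 \<in> K"
      hence "w ^ 4 / w ^ 3 \<in> K" using w subfield_divide[OF K] by blast
      moreover have "w ^ 4 / w ^ 3 = w" using w(1) by (simp add: power4_eq_xxxx power3_eq_cube)
      ultimately show False using \<open>w \<notin> K\<close> by simp
    qed
    ultimately have "n \<noteq> 1" "n \<noteq> 2" "n \<noteq> 3" using n w(3) by auto
    thus "4 \<le> n" using n by linarith
  qed
  moreover have "\<exists>n>0. w ^ n \<in> K" using w(2) by (intro exI[of _ 4]) simp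
  ultimately show ?thesis unfolding coset_order_def by simp
qed

lemma prime_dvd_elem_order:
  assumes p: "prime p" and w: "w ^ p = 1" "w \<noteq> 1"
  shows "elem_order w > 0" "p dvd elem_order w"
proof -
  have ex: "\<exists>n>0. w ^ n = 1" using w prime_gt_0_nat[OF p] by blast
  have o: "elem_order w > 0 \<and> w ^ elem_order w = 1"
    using LeastI_ex[of "\<lambda>n. n > 0 \<and> w ^ n = 1"] ex unfolding elem_order_def by auto
  thus "elem_order w > 0" by blast
  show "p dvd elem_order w"
  proof (rule ccontr)
    assume "\<not> ?thesis"
    hence "coprime (elem_order w) p" using p by (metis coprime_commute prime_imp_coprime_nat)
    thus False using power_eq_1_coprime[OF w(1)] o w(2) by blast
  qed
qed

text \<open>A relation involves finitely many elements of \<open>T\<close>, which have a common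
  exponent modulo \<open>K\<close>; the hypotheses on orders then become those of
  \<open>radicals_independent\<close>.\<close>

lemma transversal_lin_indep:
  fixes K G :: "'a::field set"
  assumes K: "is_subfield K"
    and G: "is_mult_subgroup G"
    and KG: "K - {0} \<subseteq> G"
    and torsion: "\<forall>g\<in>G. \<exists>n>0. g ^ n \<in> K"
    and four: "(\<exists>g\<in>G. coset_order K g = 4) \<longrightarrow> (\<exists>z\<in>K. primitive_root_of_unity z 4)"
    and roots: "\<forall>p \<in> pi_torsion G \<inter> pi_quot G K. \<exists>z\<in>K. primitive_root_of_unity z p"
    and char: "CHAR('a) \<notin> pi_quot G K"
    and T: "is_transversal K G T"
  shows "lin_indep_over K T"
  unfolding lin_indep_over_def
proof (intro allI impI)
  fix S c assume "finite S \<and> S \<subseteq> T \<and> (\<forall>t\<in>S. c t \<in> K) \<and> (\<Sum>t\<in>S. c t * t) = 0"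
  hence S: "finite S" "S \<subseteq> T" "\<forall>t\<in>S. c t \<in> K" "(\<Sum>t\<in>S. c t * t) = 0" by auto
  have TG: "T \<subseteq> G" using T unfolding is_transversal_def by blast
  have SG: "s \<in> G" if "s \<in> S" for s using S(2) TG that by blast
  \<comment> \<open>A common exponent of the members of \<open>S\<close>; each of its primes divides
    one of the coset orders and so belongs to \<open>pi_quot G K\<close>.\<close>
  define n where "n = (\<Prod>s\<in>S. coset_order K s)"
  have ord: "coset_order K s > 0" "s ^ coset_order K s \<in> K" if "s \<in> G" for s
    using coset_order[of s K] torsion that by auto
  have n0: "n > 0" unfolding n_def using ord SG by (intro prod_pos) auto
  have primes: "p \<in> pi_quot G K" if p: "prime p" "p dvd n" for p
  proof -
    obtain s where "s \<in> S" "p dvd coset_order K s"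
      using p S(1) unfolding n_def by (auto simp: prime_dvd_prod_iff)
    thus ?thesis unfolding pi_quot_def using p SG ord by blast
  qed
  have "independent_family K S (\<lambda>s. s)"
  proof (rule radicals_independent[OF K G KG _ n0 S(1)])
    show "(\<exists>x\<in>K. x ^ 2 = -1) \<or> (\<forall>w\<in>G. w ^ 4 \<in> K \<longrightarrow> w ^ 2 \<in> K)"
    proof (cases "\<exists>g\<in>G. coset_order K g = 4")
      case True
      then obtain z where z: "z \<in> K" "primitive_root_of_unity z 4" using four by blast
      hence "z ^ 4 = 1" "z ^ 2 \<noteq> 1" unfolding primitive_root_of_unity_def by auto
      moreover have "(z ^ 2) ^ 2 = z ^ 4" by (simp flip: power_mult)
      ultimately have "z ^ 2 = -1" by (metis power2_eq_1_iff)
      thus ?thesis using z(1) by blast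
    next
      case False
      thus ?thesis using coset_order_eq_4[OF K] mult_subgroup_nonzero[OF G] by blast
    qed
    show "s ^ n \<in> K" if "s \<in> S" for s
    proof -
      have "coset_order K s dvd n" unfolding n_def using S(1) that by (rule dvd_prodI)
      then obtain k where "n = coset_order K s * k" by auto
      thus ?thesis using ord(2)[OF SG[OF that]] subfield_power[OF K] by (simp add: power_mult)
    qed
    show "inequivalent K S (\<lambda>s. s)" unfolding inequivalent_def
    proof (intro ballI impI notI)
      fix s t assume st: "s \<in> S" "t \<in> S" "s \<noteq> t" "s / t \<in> K"
      have nz: "s \<noteq> 0" "t \<noteq> 0" using mult_subgroup_nonzero[OF G] SG st by auto
      \<comment> \<open>Both \<open>s\<close> and \<open>t\<close> would represent the coset of
        \<open>s\<close>.\<close>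
      have "s * inverse s \<in> K - {0}" "s * inverse t \<in> K - {0}"
        using nz st(4) subfield_1[OF K] by (auto simp: divide_inverse)
      moreover have "\<exists>!t. t \<in> T \<and> s * inverse t \<in> K - {0}"
        using T SG[OF st(1)] unfolding is_transversal_def by blast
      ultimately show False using st S(2) by blast
    qed
    show "of_nat p \<noteq> (0::'a)" if p: "prime p" "p dvd n" for p
    proof
      assume "of_nat p = (0::'a)"
      hence "CHAR('a) dvd p" by (simp add: of_nat_eq_0_iff_char_dvd)
      hence "CHAR('a) = p" using p(1) CHAR_not_1 by (metis One_nat_def prime_nat_iff)
      thus False using char primes[OF p] by simp
    qed
    show "w \<in> K" if p: "prime p" "p dvd n" and w: "w \<in> G" "w ^ p = 1" for p w
    proof (cases "w = 1")
      case True
      thus ?thesis using subfield_1[OF K] by simp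
    next
      case False
      \<comment> \<open>The nontrivial \<open>w\<close> itself witnesses this, so
        \<open>roots\<close> applies and \<open>w\<close> is a power of the primitive root in
        \<open>K\<close>.\<close>
      have "p \<in> pi_torsion G" unfolding pi_torsion_def
        using prime_dvd_elem_order[OF p(1) w(2) False] p(1) w(1) by blast
      then obtain z where z: "z \<in> K" "primitive_root_of_unity z p" using roots primes[OF p] by blast
      hence "z ^ p = 1" "z ^ 1 \<noteq> 1"
        using prime_gt_1_nat[OF p(1)] unfolding primitive_root_of_unity_def by (blast, blast)
      thus ?thesis using prime_root_of_unity_power[OF p(1), of z w] w(2) subfield_power[OF K z(1)] by auto
    qed
  qed (rule SG)
  thus "\<forall>t\<in>S. c t = 0" using S unfolding independent_family_def by blast
qed

section \<open>Linear spans and the generated field\<close>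

context
  fixes K T :: "'a::field set"
  assumes K: "is_subfield K"
begin

lemma span_over_0: "0 \<in> span_over K T"
  unfolding span_over_def by (auto intro!: exI[of _ "{}"])

lemma span_over_scaled: "c \<in> K \<Longrightarrow> t \<in> T \<Longrightarrow> c * t \<in> span_over K T"
  unfolding span_over_def by (auto intro!: exI[of _ "{t}"] exI[of _ "\<lambda>_. c"])

lemma span_over_add:
  assumes "x \<in> span_over K T" "y \<in> span_over K T" shows "x + y \<in> span_over K T"
proof -
  obtain S c where S: "finite S" "S \<subseteq> T" "\<forall>t\<in>S. c t \<in> K" "x = (\<Sum>t\<in>S. c t * t)"
    using assms(1) unfolding span_over_def by blast
  obtain R d where R: "finite R" "R \<subseteq> T" "\<forall>t\<in>R. d t \<in> K" "y = (\<Sum>t\<in>R. d t * t)"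
    using assms(2) unfolding span_over_def by blast
  let ?e = "\<lambda>t. (if t \<in> S then c t else 0) + (if t \<in> R then d t else 0)"
  have "x = (\<Sum>t\<in>S \<union> R. (if t \<in> S then c t else 0) * t)"
    unfolding S(4) using S(1) R(1) by (intro sum.mono_neutral_cong_left) auto
  moreover have "y = (\<Sum>t\<in>S \<union> R. (if t \<in> R then d t else 0) * t)"
    unfolding R(4) using S(1) R(1) by (intro sum.mono_neutral_cong_left) auto
  ultimately have "x + y = (\<Sum>t\<in>S \<union> R. ?e t * t)"
    by (simp add: sum.distrib[symmetric] distrib_right)
  moreover have "\<forall>t\<in>S \<union> R. ?e t \<in> K"
    using S(3) R(3) subfield_0[OF K] by (auto intro!: subfield_add[OF K])
  ultimately show ?thesis unfolding span_over_def mem_Collect_eq using S R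
    by (intro exI[of _ "S \<union> R"] exI[of _ ?e]) simp
qed

lemma span_over_sum: "(\<And>i. i \<in> I \<Longrightarrow> f i \<in> span_over K T) \<Longrightarrow> sum f I \<in> span_over K T"
  by (induction I rule: infinite_finite_induct) (auto simp: span_over_0 span_over_add)

end

text \<open>Each element of \<open>G\<close> is a \<open>K\<close>-multiple of one in
  \<open>T\<close>, so the span is closed under products because \<open>G\<close> is. Inverses are
  found in subfields inside the span, one for each finite subset of \<open>G\<close>.\<close>

lemma transversal_span:
  fixes K G :: "'a::field set"
  assumes K: "is_subfield K"
    and G: "is_mult_subgroup G"
    and KG: "K - {0} \<subseteq> G"
    and torsion: "\<forall>g\<in>G. \<exists>n>0. g ^ n \<in> K"
    and T: "is_transversal K G T"
  shows "span_over K T = gen_field K G"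
proof -
  let ?V = "span_over K T"
  have TG: "T \<subseteq> G" using T unfolding is_transversal_def by blast
  have scaled: "c * g \<in> ?V" if "c \<in> K" "g \<in> G" for c g
  proof -
    obtain t where t: "t \<in> T" "g * inverse t \<in> K"
      using T \<open>g \<in> G\<close> unfolding is_transversal_def by blast
    have "t \<noteq> 0" using t TG mult_subgroup_nonzero[OF G] by blast
    hence "c * g = c * (g * inverse t) * t" by simp
    moreover have "c * (g * inverse t) \<in> K" using that t subfield_mult[OF K] by blast
    ultimately show ?thesis using span_over_scaled[OF K _ t(1)] by metis
  qed
  have K_V: "K \<subseteq> ?V" using scaled[OF _ mult_subgroup_1[OF G]] by auto
  have G_V: "G \<subseteq> ?V" using scaled[OF subfield_1[OF K]] by auto
  have repr: "\<exists>S c. finite S \<and> S \<subseteq> G \<and> (\<forall>t\<in>S. c t \<in> K) \<and> x = (\<Sum>t\<in>S. c t * t)" if "x \<in> ?V" for x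
    using that TG unfolding span_over_def by blast
  have mult: "x * y \<in> ?V" if x: "x \<in> ?V" and y: "y \<in> ?V" for x y
  proof -
    obtain S c where S: "finite S" "S \<subseteq> G" "\<forall>t\<in>S. c t \<in> K" "x = (\<Sum>t\<in>S. c t * t)"
      using repr[OF x] by blast
    obtain R d where R: "finite R" "R \<subseteq> G" "\<forall>t\<in>R. d t \<in> K" "y = (\<Sum>t\<in>R. d t * t)"
      using repr[OF y] by blast
    have "x * y = (\<Sum>s\<in>S. \<Sum>t\<in>R. c s * d t * (s * t))"
      unfolding S(4) R(4) sum_product by (simp add: mult_ac)
    moreover have "c s * d t * (s * t) \<in> ?V" if "s \<in> S" "t \<in> R" for s t
      using that S R subfield_mult[OF K] mult_subgroup_mult[OF G] by (intro scaled) blast+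
    ultimately show ?thesis by (auto intro!: span_over_sum[OF K])
  qed
  \<comment> \<open>Each new \<open>s\<close> is a radical over \<open>E\<close>, so
    \<open>adjoin E s\<close> is a field; it stays in the span, which contains \<open>E\<close> and
    \<open>s\<close> and is closed under sums and products.\<close>
  have subfields: "\<exists>E. is_subfield E \<and> K \<subseteq> E \<and> S \<subseteq> E \<and> E \<subseteq> ?V" if "finite S" "S \<subseteq> G" for S
    using that
  proof (induction S rule: finite_induct)
    case empty
    thus ?case using K K_V by blast
  next
    case (insert s S)
    then obtain E where E: "is_subfield E" "K \<subseteq> E" "S \<subseteq> E" "E \<subseteq> ?V" by auto
    have s: "s \<in> G" using insert.prems by blast
    then obtain n where n: "n > 0" "s ^ n \<in> K" using torsion by blast
    have "s ^ n \<in> E" using n(2) E(2) by blast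
    hence "is_subfield (adjoin E s)"
      using is_subfield_adjoin[OF E(1) radical_poly(1,2)[OF E(1) n(1)]] by (simp add: poly_monom)
    moreover have "adjoin E s \<subseteq> ?V"
    proof
      fix x assume "x \<in> adjoin E s"
      then obtain q where q: "poly_over E q" "x = poly q s" unfolding adjoin_def by blast
      have "poly q s \<in> ?V" using q(1)
      proof (induction q)
        case 0
        thus ?case using span_over_0[OF K] by simp
      next
        case (pCons a q)
        thus ?case using E s G_V by (auto intro!: span_over_add[OF K] mult simp: poly_over_pCons[OF E(1)])
      qed
      thus "x \<in> ?V" using q by simp
    qed
    moreover have "K \<subseteq> adjoin E s" "insert s S \<subseteq> adjoin E s"
      using subset_adjoin[OF E(1), of s] adjoin_contains[OF E(1), of s] E by auto
    ultimately show ?case by blast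
  qed
  have inv: "inverse x \<in> ?V" if x: "x \<in> ?V" for x
  proof -
    obtain S c where S: "finite S" "S \<subseteq> G" "\<forall>t\<in>S. c t \<in> K" "x = (\<Sum>t\<in>S. c t * t)"
      using repr[OF x] by blast
    obtain E where E: "is_subfield E" "K \<subseteq> E" "S \<subseteq> E" "E \<subseteq> ?V" using subfields[OF S(1,2)] by blast
    have "x \<in> E" unfolding S(4) using E S by (auto intro!: subfield_sum[OF E(1)] subfield_mult[OF E(1)])
    thus ?thesis using subfield_inverse[OF E(1)] E(4) by blast
  qed
  have neg: "- x \<in> ?V" if "x \<in> ?V" for x
    using mult[OF _ that, of "- 1"] K_V subfield_uminus[OF K subfield_1[OF K]] by auto
  have "0 \<in> ?V" "1 \<in> ?V" using K_V subfield_0[OF K] subfield_1[OF K] by auto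
  hence "is_subfield ?V" unfolding is_subfield_def
    using span_over_add[OF K] mult neg inv by (intro conjI ballI)
  hence "gen_field K G \<subseteq> ?V" unfolding gen_field_def using K_V G_V by blast
  moreover have "x \<in> F" if x: "x \<in> ?V" and F: "is_subfield F" "K \<union> G \<subseteq> F" for x F
  proof -
    obtain S c where S: "finite S" "S \<subseteq> G" "\<forall>t\<in>S. c t \<in> K" "x = (\<Sum>t\<in>S. c t * t)"
      using repr[OF x] by blast
    thus ?thesis using F(2) by (auto intro!: subfield_sum[OF F(1)] subfield_mult[OF F(1)])
  qed
  ultimately show ?thesis unfolding gen_field_def by blast
qed

theorem theorem1p3:
  fixes K G :: "'a::field set"
  assumes "is_subfield K"
    and "is_mult_subgroup G"
    and "K - {0} \<subseteq> G"
    and "\<forall>g\<in>G. \<exists>n>0. g ^ n \<in> K"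
    and "(\<exists>g\<in>G. coset_order K g = 4) \<longrightarrow> (\<exists>z\<in>K. primitive_root_of_unity z 4)"
    and "\<forall>p \<in> pi_torsion G \<inter> pi_quot G K. \<exists>z\<in>K. primitive_root_of_unity z p"
    and "CHAR('a) \<notin> pi_quot G K"
  shows "\<forall>T. is_transversal K G T \<longrightarrow>
           lin_indep_over K T \<and> span_over K T = gen_field K G"
  using transversal_lin_indep[OF assms] transversal_span[OF assms(1-4)] by blast

end
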